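(* Let $T$ be a rational pinwheel tiling with associated planar graph $RP$. Then the chromatic number of $RP$ is $\chi(RP)=3$.
   Context: Rational pinwheel substitution. The prototile $K$ is the right triangle with side lengths $1,2,\sqrt5$. The substitution $\omega$ expands a tile by $\sqrt5$ and dissects it into five tiles: the expanded tile, placed as the triangle with vertices $(0,0)$ (right angle), $(2,-1)$, $(2,4)$, is dissected into the triangles with vertices $\{(2,-1),(2,0),(0,0)\}$, $\{(0,0),(1,0),(1,2)\}$, $\{(1,0),(2,0),(2,2)\}$, $\{(1,0),(1,2),(2,2)\}$, $\{(1,2),(2,2),(2,4)\}$. The rule is extended to all congruent copies of $K$ (including reflections) and to collections of tiles covariantly. A rational pinwheel tiling is a tiling $T$ of $\mathbb{R}^2$ by congruent copies of $K$ such that every finite set of tiles of $T$ is contained in a congruent copy of $\omega^n(K)$ for some $n\ge0$. Graph: the vertices are all points that are a corner of at least one tile; the edges are the segments, contained in tile boundaries, joining consecutive vertices (so a tile side containing vertices in its interior is subdivided by them). *)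

theory Defs
  imports "HOL-Analysis.Analysis" "HOL-Library.Extended_Nat"
begin

text \<open>
  The plane is \<^typ>\<open>real \<times> real\<close>, whose \<^const>\<open>dist\<close> is the Euclidean metric. A tile is a
  closed triangle, represented as a point set; a patch or a tiling is a set of tiles.
\<close>

type_synonym plane = "real \<times> real"
type_synonym tile = "plane set"

section \<open>Congruence\<close>

text \<open>Distance-preserving maps; orientation-reversing ones are included.\<close>

definition isometry_plane :: "(plane \<Rightarrow> plane) \<Rightarrow> bool" where
  "isometry_plane g \<longleftrightarrow> (\<forall>x y. dist (g x) (g y) = dist x y)"

definition congruent :: "plane set \<Rightarrow> plane set \<Rightarrow> bool" where
  "congruent A B \<longleftrightarrow> (\<exists>g. isometry_plane g \<and> B = g ` A)"

definition congruent_patch :: "tile set \<Rightarrow> tile set \<Rightarrow> bool" where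
  "congruent_patch P Q \<longleftrightarrow> (\<exists>g. isometry_plane g \<and> Q = (`) g ` P)"

section \<open>The rational pinwheel substitution\<close>

definition prototile :: tile where
  "prototile = convex hull {(0, 0), (1, 0), (0, 2)}"

definition expanded_prototile :: tile where
  "expanded_prototile = convex hull {(0, 0), (2, -1), (2, 4)}"

definition dissection :: "tile set" where
  "dissection =
    {convex hull {(2, -1), (2, 0), (0, 0)},
     convex hull {(0, 0), (1, 0), (1, 2)},
     convex hull {(1, 0), (2, 0), (2, 2)},
     convex hull {(1, 0), (1, 2), (2, 2)},
     convex hull {(1, 2), (2, 2), (2, 4)}}"

text \<open>
  Covariant extension to all congruent copies of the prototile: transport the dissection along
  the isometry carrying the placed expanded prototile onto the expanded tile. As the side
  lengths of the triangle are distinct, there is exactly one such isometry.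
\<close>

definition substitution_tile :: "tile \<Rightarrow> tile set" where
  "substitution_tile t =
    {g ` d | g d. isometry_plane g \<and> g ` expanded_prototile = (\<lambda>x. sqrt 5 *\<^sub>R x) ` t
                  \<and> d \<in> dissection}"

definition substitution :: "tile set \<Rightarrow> tile set" where
  "substitution P = (\<Union>t\<in>P. substitution_tile t)"

section \<open>Tilings\<close>

definition tiling_by :: "tile \<Rightarrow> tile set \<Rightarrow> bool" where
  "tiling_by K T \<longleftrightarrow>
    (\<forall>t\<in>T. congruent K t) \<and> \<Union>T = UNIV \<and>
    (\<forall>s\<in>T. \<forall>t\<in>T. s \<noteq> t \<longrightarrow> interior s \<inter> interior t = {})"

definition rational_pinwheel_tiling :: "tile set \<Rightarrow> bool" where
  "rational_pinwheel_tiling T \<longleftrightarrow>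
    tiling_by prototile T \<and>
    (\<forall>F. finite F \<and> F \<subseteq> T \<longrightarrow>
      (\<exists>n Q. congruent_patch ((substitution ^^ n) {prototile}) Q \<and> F \<subseteq> Q))"

section \<open>The graph of a tiling\<close>

text \<open>The corners of a triangle are its extreme points.\<close>

definition tiling_vertices :: "tile set \<Rightarrow> plane set" where
  "tiling_vertices T = {x. \<exists>t\<in>T. x extreme_point_of t}"

text \<open>
  A segment inside the boundary of a triangle lies on one of its sides, so the edges are the
  pieces into which the tile sides are cut by the vertices lying on them. A segment is
  represented by its pair of end points.
\<close>

definition tiling_edges :: "tile set \<Rightarrow> plane set set" where
  "tiling_edges T =
    {{u, v} | u v. u \<in> tiling_vertices T \<and> v \<in> tiling_vertices T \<and> u \<noteq> v \<and>
       (\<exists>t\<in>T. closed_segment u v \<subseteq> frontier t) \<and>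
       open_segment u v \<inter> tiling_vertices T = {}}"

section \<open>Chromatic number\<close>

definition proper_colouring :: "'a set \<Rightarrow> 'a set set \<Rightarrow> nat \<Rightarrow> ('a \<Rightarrow> nat) \<Rightarrow> bool" where
  "proper_colouring V E k c \<longleftrightarrow>
    c ` V \<subseteq> {..<k} \<and> (\<forall>u\<in>V. \<forall>v\<in>V. {u, v} \<in> E \<longrightarrow> c u \<noteq> c v)"

text \<open>The value is \<open>\<infinity>\<close> if there is no proper colouring with finitely many colours.\<close>

definition chromatic_number :: "'a set \<Rightarrow> 'a set set \<Rightarrow> enat" where
  "chromatic_number V E = (INF k \<in> {k. \<exists>c. proper_colouring V E k c}. enat k)"

end

theory Submission
  imports Defs
begin

text \<open>
  Proof idea. Every finite part of the tiling lies in a copy of an iterate \<open>\<omega>\<^sup>n(K)\<close>, so by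
  compactness (Tychonoff) it suffices to colour these patches. Inside a patch, tiles meet in a
  controlled way: a hypotenuse is only met by another full hypotenuse, and legs are only cut into
  pieces of unit length. Rotate and scale so that all vertices have coordinates in \<open>\<int>[1/5]\<close>; as 5
  is odd, vertices have a parity. Colour \<open>\<omega>(P)\<close> by 0 at the vertices of \<open>P\<close> and at the midpoints
  of its long legs, and by 1 or 2 according to parity elsewhere. This is not a proper colouring of
  \<open>\<omega>(P)\<close>, but it can be extended to a proper 3-colouring of \<open>\<omega>(\<omega>(P))\<close>. Conversely, the middle one
  of the five tiles of a dissection has no vertex in the interior of a side, so it is a triangle of
  the graph.
\<close>

section \<open>Tiles and their dissection\<close>

text \<open>One substitution exchanges the two kinds of side: a unit piece of a leg becomes the
  hypotenuse of a child, and a hypotenuse is cut into five unit leg pieces, in a pattern invariant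
  under reversal. Hence the meeting rules reproduce themselves. The parity colouring fails on
  \<open>\<omega>(P)\<close> because the hypotenuses of the children A, B, E join two points
  coloured 0. The next substitution cuts these edges, but how depends on the tile across. A mirror
  image has its corners on the hypotenuse at the same two places; a tile turned by 180 degrees adds
  two more. Parity tells the cases apart: the right angles of two tiles with a common hypotenuse
  have equal parity in the first case and opposite parity in the second. The patches are built by
  repeatedly dissecting one fixed triangle and are scaled by a power of \<open>sqrt 5\<close> only
  when compared with the substitution; this keeps the coordinates rational. Patches with different
  ancestors receive colourings that nothing forces to agree, hence the compactness argument.\<close>

text \<open>
  A frame \<open>(p, u, v)\<close> stands for the tile with right angle \<open>p\<close>, short leg \<open>u\<close> and long leg \<open>2v\<close>.
  The coordinates of \<open>pt\<close> are those of the expanded prototile with corners \<open>(0, 0)\<close>, \<open>(2, -1)\<close>,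
  \<open>(2, 4)\<close>, so that the dissection points have the integer coordinates of its definition. The
  letters p, q, r, m denote the right angle, the far end of the short leg, the far end of the long
  leg and the midpoint of the long leg.
\<close>

type_synonym frame = "plane \<times> plane \<times> plane"

definition pt :: "frame \<Rightarrow> real \<Rightarrow> real \<Rightarrow> plane" where
  "pt t x y = (case t of (p, u, v) \<Rightarrow> p + ((2 * x - y) / 5) *\<^sub>R u + ((x + 2 * y) / 5) *\<^sub>R v)"

definition vp :: "frame \<Rightarrow> plane" where "vp t = pt t 0 0"
definition vq :: "frame \<Rightarrow> plane" where "vq t = pt t 2 (- 1)"
definition vr :: "frame \<Rightarrow> plane" where "vr t = pt t 2 4"
definition vm :: "frame \<Rightarrow> plane" where "vm t = pt t 1 2"

text \<open>The lines x = 2, x + 2 y = 0 and y = 2 x carry the hypotenuse, the short leg and the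
  long leg. Inequalities instead of a convex hull turn incidence questions into linear
  arithmetic.\<close>

definition tile_of :: "frame \<Rightarrow> tile" where
  "tile_of t = {pt t x y | x y. x \<le> 2 \<and> 0 \<le> x + 2 * y \<and> y \<le> 2 * x}"

definition inner_tile :: "frame \<Rightarrow> tile" where
  "inner_tile t = {pt t x y | x y. x < 2 \<and> 0 < x + 2 * y \<and> y < 2 * x}"

text \<open>Here \<open>a\<close> is a position while \<open>b\<close> and \<open>c\<close> are
  directions, hence the subtraction of \<open>pt t 0 0\<close>.\<close>

definition subframe :: "frame \<Rightarrow> real \<times> real \<Rightarrow> real \<times> real \<Rightarrow> real \<times> real \<Rightarrow> frame" where
  "subframe t a b c = (pt t (fst a) (snd a),
     pt t (fst b) (snd b) - pt t 0 0, pt t (fst c) (snd c) - pt t 0 0)"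

definition chA :: "frame \<Rightarrow> frame" where "chA t = subframe t (2, 0) (0, - 1) (- 1, 0)"
definition chB :: "frame \<Rightarrow> frame" where "chB t = subframe t (1, 0) (- 1, 0) (0, 1)"
definition chC :: "frame \<Rightarrow> frame" where "chC t = subframe t (2, 0) (- 1, 0) (0, 1)"
definition chD :: "frame \<Rightarrow> frame" where "chD t = subframe t (1, 2) (1, 0) (0, - 1)"
definition chE :: "frame \<Rightarrow> frame" where "chE t = subframe t (2, 2) (- 1, 0) (0, 1)"

definition children :: "frame \<Rightarrow> frame set" where
  "children t = {chA t, chB t, chC t, chD t, chE t}"

definition corners :: "frame \<Rightarrow> plane set" where "corners t = {vp t, vq t, vr t}"
text \<open>The midpoint of the long leg is the only point inside a side where a neighbour in a
  matched patch can have a corner; (1, 0) on the long leg of child A is an example.\<close>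

definition marks :: "frame \<Rightarrow> plane set" where "marks t = {vp t, vq t, vr t, vm t}"

definition hyp :: "frame \<Rightarrow> plane set" where "hyp t = open_segment (vq t) (vr t)"
definition pieces :: "frame \<Rightarrow> plane set set" where
  "pieces t = {open_segment (vp t) (vq t), open_segment (vp t) (vm t), open_segment (vm t) (vr t)}"

definition nondeg :: "frame \<Rightarrow> bool" where
  "nondeg t \<longleftrightarrow> (case t of (p, u, v) \<Rightarrow> u \<bullet> v = 0 \<and> u \<bullet> u = v \<bullet> v \<and> u \<noteq> 0)"

lemma pt_eq_iff:
  assumes "nondeg t"
  shows "pt t x y = pt t x' y' \<longleftrightarrow> x = x' \<and> y = y'"
proof
  obtain p u v where t: "t = (p, u, v)" by (cases t)
  have uv: "u \<bullet> v = 0" "v \<bullet> u = 0" "u \<bullet> u \<noteq> 0" "v \<bullet> v \<noteq> 0"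
    using assms by (auto simp: nondeg_def t inner_commute)
  assume "pt t x y = pt t x' y'"
  then have eq: "((2 * x - y) / 5) *\<^sub>R u + ((x + 2 * y) / 5) *\<^sub>R v =
      ((2 * x' - y') / 5) *\<^sub>R u + ((x' + 2 * y') / 5) *\<^sub>R v" (is "?l = ?r")
    by (simp add: pt_def t)
  have "?l \<bullet> u = ?r \<bullet> u" "?l \<bullet> v = ?r \<bullet> v" using eq by simp_all
  then have "2 * x - y = 2 * x' - y'" "x + 2 * y = x' + 2 * y'"
    using uv by (simp_all add: inner_add_left)
  then show "x = x' \<and> y = y'" by linarith
qed auto

lemma pt_subframe:
  "pt (subframe t a b c) x y =
    pt t (fst a + ((2 * x - y) / 5) * fst b + ((x + 2 * y) / 5) * fst c)
         (snd a + ((2 * x - y) / 5) * snd b + ((x + 2 * y) / 5) * snd c)"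
proof -
  obtain p u v where t: "t = (p, u, v)" by (cases t)
  show ?thesis unfolding t subframe_def pt_def by (simp add: prod_eq_iff field_simps)
qed

lemma pt_child:
  "pt (chA t) x y = pt t (2 - (x + 2 * y) / 5) ((y - 2 * x) / 5)"
  "pt (chB t) x y = pt t (1 - (2 * x - y) / 5) ((x + 2 * y) / 5)"
  "pt (chC t) x y = pt t (2 - (2 * x - y) / 5) ((x + 2 * y) / 5)"
  "pt (chD t) x y = pt t (1 + (2 * x - y) / 5) (2 - (x + 2 * y) / 5)"
  "pt (chE t) x y = pt t (2 - (2 * x - y) / 5) (2 + (x + 2 * y) / 5)"
  unfolding chA_def chB_def chC_def chD_def chE_def pt_subframe
  by (rule arg_cong2[where f = "pt t"]; simp add: field_simps)+

lemma child_points: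
  "vp (chA t) = pt t 2 0" "vq (chA t) = pt t 2 (- 1)" "vr (chA t) = pt t 0 0" "vm (chA t) = pt t 1 0"
  "vp (chB t) = pt t 1 0" "vq (chB t) = pt t 0 0" "vr (chB t) = pt t 1 2" "vm (chB t) = pt t 1 1"
  "vp (chC t) = pt t 2 0" "vq (chC t) = pt t 1 0" "vr (chC t) = pt t 2 2" "vm (chC t) = pt t 2 1"
  "vp (chD t) = pt t 1 2" "vq (chD t) = pt t 2 2" "vr (chD t) = pt t 1 0" "vm (chD t) = pt t 1 1"
  "vp (chE t) = pt t 2 2" "vq (chE t) = pt t 1 2" "vr (chE t) = pt t 2 4" "vm (chE t) = pt t 2 3"
  by (simp_all add: vp_def vq_def vr_def vm_def pt_child)

text \<open>A change of variables: \<open>f\<close>, \<open>g\<close> express the parent coordinates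
  through those of a child, and \<open>f'\<close>, \<open>g'\<close> invert them. The witnesses in
  the two lemmas on children are these inverses.\<close>

lemma reparametrize:
  assumes "\<And>x y. P x y \<Longrightarrow> Q (f x y) (g x y)"
    and "\<And>x y. Q x y \<Longrightarrow> P (f' x y) (g' x y) \<and> f (f' x y) (g' x y) = x \<and> g (f' x y) (g' x y) = y"
  shows "{pt t (f x y) (g x y) | x y. P x y} = {pt t x y | x y. Q x y}"
proof (intro set_eqI iffI)
  fix z assume "z \<in> {pt t x y | x y. Q x y}"
  then obtain x y where "z = pt t x y" "Q x y" by blast
  then show "z \<in> {pt t (f x y) (g x y) | x y. P x y}"
    using assms(2)[of x y] by (auto intro!: exI[of _ "f' x y"] exI[of _ "g' x y"])
qed (use assms(1) in blast)

lemma tile_of_child: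
  "tile_of (chA t) = {pt t x y | x y. y \<le> 0 \<and> x \<le> 2 \<and> 0 \<le> x + 2 * y}"
  "tile_of (chB t) = {pt t x y | x y. 0 \<le> y \<and> x \<le> 1 \<and> y \<le> 2 * x}"
  "tile_of (chC t) = {pt t x y | x y. 0 \<le> y \<and> x \<le> 2 \<and> y \<le> 2 * (x - 1)}"
  "tile_of (chD t) = {pt t x y | x y. y \<le> 2 \<and> 1 \<le> x \<and> 2 * (x - 1) \<le> y}"
  "tile_of (chE t) = {pt t x y | x y. 2 \<le> y \<and> x \<le> 2 \<and> y \<le> 2 * x}"
  unfolding tile_of_def pt_child
  subgoal by (rule reparametrize[where f' = "\<lambda>x y. (2 - x) - 2 * y" and g' = "\<lambda>x y. 2 * (2 - x) + y"])
      (auto simp: field_simps)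
  subgoal by (rule reparametrize[where f' = "\<lambda>x y. 2 * (1 - x) + y" and g' = "\<lambda>x y. 2 * y - (1 - x)"])
      (auto simp: field_simps)
  subgoal by (rule reparametrize[where f' = "\<lambda>x y. 2 * (2 - x) + y" and g' = "\<lambda>x y. 2 * y - (2 - x)"])
      (auto simp: field_simps)
  subgoal by (rule reparametrize[where f' = "\<lambda>x y. 2 * (x - 1) + (2 - y)" and g' = "\<lambda>x y. 2 * (2 - y) - (x - 1)"])
      (auto simp: field_simps)
  subgoal by (rule reparametrize[where f' = "\<lambda>x y. 2 * (2 - x) + (y - 2)" and g' = "\<lambda>x y. 2 * (y - 2) - (2 - x)"])
      (auto simp: field_simps)
  done

lemma inner_tile_child:
  "inner_tile (chA t) = {pt t x y | x y. y < 0 \<and> x < 2 \<and> 0 < x + 2 * y}"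
  "inner_tile (chB t) = {pt t x y | x y. 0 < y \<and> x < 1 \<and> y < 2 * x}"
  "inner_tile (chC t) = {pt t x y | x y. 0 < y \<and> x < 2 \<and> y < 2 * (x - 1)}"
  "inner_tile (chD t) = {pt t x y | x y. y < 2 \<and> 1 < x \<and> 2 * (x - 1) < y}"
  "inner_tile (chE t) = {pt t x y | x y. 2 < y \<and> x < 2 \<and> y < 2 * x}"
  unfolding inner_tile_def pt_child
  subgoal by (rule reparametrize[where f' = "\<lambda>x y. (2 - x) - 2 * y" and g' = "\<lambda>x y. 2 * (2 - x) + y"])
      (auto simp: field_simps)
  subgoal by (rule reparametrize[where f' = "\<lambda>x y. 2 * (1 - x) + y" and g' = "\<lambda>x y. 2 * y - (1 - x)"])
      (auto simp: field_simps)
  subgoal by (rule reparametrize[where f' = "\<lambda>x y. 2 * (2 - x) + y" and g' = "\<lambda>x y. 2 * y - (2 - x)"])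
      (auto simp: field_simps)
  subgoal by (rule reparametrize[where f' = "\<lambda>x y. 2 * (x - 1) + (2 - y)" and g' = "\<lambda>x y. 2 * (2 - y) - (x - 1)"])
      (auto simp: field_simps)
  subgoal by (rule reparametrize[where f' = "\<lambda>x y. 2 * (2 - x) + (y - 2)" and g' = "\<lambda>x y. 2 * (y - 2) - (2 - x)"])
      (auto simp: field_simps)
  done

lemma open_segment_pt:
  assumes "z \<in> open_segment (pt t x y) (pt t x' y')"
  obtains s where "0 < s" "s < 1" "z = pt t (x + s * (x' - x)) (y + s * (y' - y))"
proof -
  obtain p u v where t: "t = (p, u, v)" by (cases t)
  obtain s where s: "0 < s" "s < 1" "z = (1 - s) *\<^sub>R pt t x y + s *\<^sub>R pt t x' y'"
    using assms by (auto simp: in_segment)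
  have "z = pt t (x + s * (x' - x)) (y + s * (y' - y))"
    unfolding s(3) t by (simp add: pt_def prod_eq_iff field_simps)
  with s that show thesis by blast
qed

lemma segment_meets:
  assumes "nondeg t" "open_segment (pt t x y) (pt t x' y') \<inter> {pt t a b | a b. R a b} \<noteq> {}"
  shows "\<exists>s. 0 < s \<and> s < 1 \<and> R (x + s * (x' - x)) (y + s * (y' - y))"
proof -
  obtain z where z: "z \<in> open_segment (pt t x y) (pt t x' y')" "z \<in> {pt t a b | a b. R a b}"
    using assms(2) by blast
  from z(1) obtain s where "0 < s" "s < 1" "z = pt t (x + s * (x' - x)) (y + s * (y' - y))"
    by (rule open_segment_pt)
  with z(2) show ?thesis by (auto simp: pt_eq_iff[OF assms(1)])
qed

lemma segment_subset_inner:
  assumes "\<And>s. 0 < s \<Longrightarrow> s < 1 \<Longrightarrow>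
    x + s * (x' - x) < 2 \<and> 0 < (x + s * (x' - x)) + 2 * (y + s * (y' - y)) \<and>
    y + s * (y' - y) < 2 * (x + s * (x' - x))"
  shows "open_segment (pt t x y) (pt t x' y') \<subseteq> inner_tile t"
proof
  fix z assume "z \<in> open_segment (pt t x y) (pt t x' y')"
  then obtain s where "0 < s" "s < 1" "z = pt t (x + s * (x' - x)) (y + s * (y' - y))"
    by (rule open_segment_pt)
  then show "z \<in> inner_tile t" using assms[of s] unfolding inner_tile_def by blast
qed

definition hyp_points :: "frame \<Rightarrow> plane set" where
  "hyp_points t = {pt t 2 0, pt t 2 1, pt t 2 2, pt t 2 3}"

definition hyp_pieces :: "frame \<Rightarrow> plane set set" where
  "hyp_pieces t = {open_segment (pt t 2 (- 1)) (pt t 2 0), open_segment (pt t 2 0) (pt t 2 1),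
     open_segment (pt t 2 1) (pt t 2 2), open_segment (pt t 2 2) (pt t 2 3),
     open_segment (pt t 2 3) (pt t 2 4)}"

section \<open>How the children meet each other and the sides of their parent\<close>

lemma childE:
  assumes "d \<in> children t"
  obtains "d = chA t" | "d = chB t" | "d = chC t" | "d = chD t" | "d = chE t"
  using assms by (auto simp: children_def)

lemma children_inner_disjoint:
  assumes "nondeg t" "d \<in> children t" "d' \<in> children t" "d \<noteq> d'"
  shows "inner_tile d' \<inter> tile_of d = {}"
  using assms(2-4)
  by (elim childE) (auto simp: tile_of_child inner_tile_child pt_eq_iff[OF assms(1)])

lemma children_marks:
  assumes "nondeg t" "d \<in> children t" "d' \<in> children t"
  shows "marks d' \<inter> tile_of d \<subseteq> marks d"
  using assms(2-3)
  by (elim childE) (auto simp: tile_of_child marks_def child_points pt_eq_iff[OF assms(1)])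

text \<open>The long leg of A is split at its midpoint into the short legs of B and C, the long legs
  of B and D coincide in opposite directions with the same midpoint, and D and E share their short
  leg.\<close>

lemma children_pieces:
  assumes nd: "nondeg t" and "d \<in> children t" "d' \<in> children t" "X \<in> pieces d'" "X \<inter> tile_of d \<noteq> {}"
  shows "X \<in> pieces d"
  using assms(2-5)
  apply (elim childE)
  apply (simp_all only: pieces_def child_points insert_iff empty_iff simp_thms tile_of_child)
  \<comment> \<open>In each case either the sets are disjoint, which is linear arithmetic in the
    segment parameter, or the segments agree up to orientation.\<close>
  apply ((elim disjE; hypsubst); ((rule FalseE, drule segment_meets[OF nd], auto; fail) | (simp (no_asm) add: open_segment_commute insert_commute; fail)))+
  done

text \<open>The hypotenuses of A, B, E lie on the legs of the parent and meet no sibling; those of C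
  and D are the same segment.\<close>

lemma children_hyp:
  assumes nd: "nondeg t" and "d \<in> children t" "d' \<in> children t" "hyp d' \<inter> tile_of d \<noteq> {}"
  shows "hyp d' = hyp d"
  using assms(2-4)
  apply (elim childE)
  apply (simp_all only: hyp_def child_points tile_of_child)
  apply ((rule FalseE, drule segment_meets[OF nd], auto; fail) | simp (no_asm) add: open_segment_commute insert_commute)+
  done

lemma parent_marks_child:
  assumes "nondeg t" "d \<in> children t"
  shows "marks t \<inter> tile_of d \<subseteq> corners d"
  using assms(2)
  by (elim childE) (auto simp: tile_of_child corners_def marks_def child_points pt_eq_iff[OF assms(1)]
    vp_def[of t] vq_def[of t] vr_def[of t] vm_def[of t])

lemma hyp_points_child:
  assumes "nondeg t" "d \<in> children t"
  shows "hyp_points t \<inter> tile_of d \<subseteq> marks d"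
  using assms(2)
  by (elim childE) (auto simp: tile_of_child marks_def hyp_points_def child_points pt_eq_iff[OF assms(1)])

text \<open>The short leg of the parent is the hypotenuse of A, and the halves of its long leg are
  those of B and E.\<close>

lemma parent_pieces_child:
  assumes nd: "nondeg t" and "d \<in> children t" "X \<in> pieces t" "X \<inter> tile_of d \<noteq> {}"
  shows "X = hyp d"
  using assms(2-4)
  apply (elim childE)
  apply (simp_all only: hyp_def pieces_def child_points vp_def[of t] vq_def[of t] vr_def[of t] vm_def[of t]
      insert_iff empty_iff simp_thms tile_of_child)
  apply ((elim disjE; hypsubst); ((rule FalseE, drule segment_meets[OF nd], auto; fail) | (simp (no_asm) add: open_segment_commute insert_commute; fail)))+
  done

lemma hyp_pieces_child:
  assumes nd: "nondeg t" and "d \<in> children t" "X \<in> hyp_pieces t" "X \<inter> tile_of d \<noteq> {}"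
  shows "X \<in> pieces d"
  using assms(2-4)
  apply (elim childE)
  apply (simp_all only: hyp_pieces_def pieces_def child_points insert_iff empty_iff simp_thms tile_of_child)
  apply ((elim disjE; hypsubst); ((rule FalseE, drule segment_meets[OF nd], auto; fail) | (simp (no_asm) add: open_segment_commute insert_commute; fail)))+
  done

lemma tile_of_child_subset: "d \<in> children t \<Longrightarrow> tile_of d \<subseteq> tile_of t"
  by (elim childE; hypsubst; unfold tile_of_child; unfold tile_of_def; force)

lemma inner_tile_child_subset: "d \<in> children t \<Longrightarrow> inner_tile d \<subseteq> inner_tile t"
  by (elim childE; hypsubst; unfold inner_tile_child; unfold inner_tile_def; force)

text \<open>The only new marks away from the hypotenuse of the parent are (1, 0) and (1, 1), both
  interior. The matching proof treats these three kinds of points separately.\<close>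

lemma marks_child_cases:
  assumes "d \<in> children t" "x \<in> marks d"
  shows "x \<in> marks t \<or> x \<in> hyp_points t \<or> x \<in> inner_tile t"
proof -
  have "pt t 1 0 \<in> inner_tile t" "pt t 1 1 \<in> inner_tile t" by (force simp: inner_tile_def)+
  with assms show ?thesis
    by (elim childE) (auto simp: marks_def hyp_points_def child_points vp_def[of t] vq_def[of t] vr_def[of t] vm_def[of t])
qed

lemma hyp_child_cases:
  assumes "d \<in> children t"
  shows "hyp d \<in> pieces t \<or> hyp d \<subseteq> inner_tile t"
proof -
  have "open_segment (pt t 1 0) (pt t 2 2) \<subseteq> inner_tile t"
    by (rule segment_subset_inner) auto
  with assms show ?thesis
    by (elim childE) (auto simp: hyp_def pieces_def child_points open_segment_commute
       vp_def[of t] vq_def[of t] vr_def[of t] vm_def[of t])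
qed

lemma pieces_child_cases:
  assumes "d \<in> children t" "X \<in> pieces d"
  shows "X \<in> hyp_pieces t \<or> X \<subseteq> inner_tile t"
proof -
  have *: "open_segment (pt t 2 0) (pt t 1 0) \<subseteq> inner_tile t" 
    "open_segment (pt t 1 0) (pt t 0 0) \<subseteq> inner_tile t"
    "open_segment (pt t 1 0) (pt t 1 1) \<subseteq> inner_tile t"
    "open_segment (pt t 1 1) (pt t 1 2) \<subseteq> inner_tile t"
    "open_segment (pt t 1 2) (pt t 2 2) \<subseteq> inner_tile t"
    by (rule segment_subset_inner; auto)+
  from assms show ?thesis
    by (elim childE; simp only: pieces_def child_points insert_iff empty_iff simp_thms)
       (elim disjE; use * in \<open>simp add: hyp_pieces_def open_segment_commute\<close>)+
qed

text \<open>A point with x = 2 depends only on the two ends of the hypotenuse, so tiles sharing a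
  hypotenuse can be compared without knowing their right angles.\<close>

lemma pt_hyp: "pt t 2 y = ((4 - y) / 5) *\<^sub>R vq t + ((1 + y) / 5) *\<^sub>R vr t"
proof -
  obtain p u v where t: "t = (p, u, v)" by (cases t)
  show ?thesis unfolding t vq_def vr_def pt_def by (simp add: prod_eq_iff field_simps)
qed

lemma pt_hyp_inner:
  assumes "nondeg t" "- 1 < y" "y < 4"
  shows "pt t 2 y \<in> hyp t"
proof -
    have "pt t 2 y = (1 - (1 + y) / 5) *\<^sub>R vq t + ((1 + y) / 5) *\<^sub>R vr t"
      by (simp add: pt_hyp field_simps)
    moreover have "vq t \<noteq> vr t" by (simp add: vq_def vr_def pt_eq_iff[OF assms(1)])
    ultimately show ?thesis using assms unfolding hyp_def in_segment by (auto intro!: exI[of _ "(1 + y) / 5"])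
qed

lemma hyp_points_subset: "nondeg t \<Longrightarrow> hyp_points t \<subseteq> hyp t"
  by (simp add: hyp_points_def pt_hyp_inner)

lemma hyp_pieces_subset:
  assumes nd: "nondeg t" and "X \<in> hyp_pieces t"
  shows "X \<subseteq> hyp t"
proof -
  have *: "open_segment (pt t 2 a) (pt t 2 b) \<subseteq> hyp t" if "- 1 \<le> a" "a < b" "b \<le> 4" for a b
  proof
    fix z assume "z \<in> open_segment (pt t 2 a) (pt t 2 b)"
    then obtain s where s: "0 < s" "s < 1" "z = pt t (2 + s * (2 - 2)) (a + s * (b - a))"
      by (rule open_segment_pt)
    have "s * (b - a) < 1 * (b - a)" by (rule mult_strict_right_mono) (use s that in auto)
    then have "a + s * (b - a) < a + (b - a)" by (simp only: add_strict_left_mono mult_1)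
    then have "a + s * (b - a) < b" by simp
    moreover have "0 < s * (b - a)" using s that by simp
    ultimately show "z \<in> hyp t" using s(3) that pt_hyp_inner[OF nd, of "a + s * (b - a)"] by simp
  qed
  show ?thesis using assms(2) unfolding hyp_pieces_def by (elim insertE emptyE; simp add: *)
qed

lemma hyp_eq_cases:
  assumes "nondeg t" "hyp t' = hyp t"
  shows "(vq t' = vq t \<and> vr t' = vr t) \<or> (vq t' = vr t \<and> vr t' = vq t)"
proof -
  have "vq t \<noteq> vr t" by (simp add: vq_def vr_def pt_eq_iff[OF assms(1)])
  then show ?thesis using assms(2) unfolding hyp_def open_segment_eq by (auto simp: doubleton_eq_iff)
qed

lemma pt_hyp_reflected:
  assumes "vq t' = vq t" "vr t' = vr t"
  shows "pt t' 2 y = pt t 2 y"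
  using assms by (simp add: pt_hyp)

text \<open>Reversing the hypotenuse exchanges its ends y = -1 and y = 4, hence y and 3 - y. The cut
  points 0, 1, 2, 3 are permuted by this, which makes the next two lemmas hold.\<close>

lemma pt_hyp_rotated:
  assumes "vq t' = vr t" "vr t' = vq t"
  shows "pt t' 2 y = pt t 2 (3 - y)"
  using assms by (simp add: pt_hyp)

lemma hyp_points_cong:
  assumes "nondeg t" "hyp t' = hyp t"
  shows "hyp_points t' = hyp_points t"
  using hyp_eq_cases[OF assms] by (auto simp: hyp_points_def pt_hyp_reflected[of t' t] pt_hyp_rotated[of t' t])

lemma hyp_pieces_cong:
  assumes "nondeg t" "hyp t' = hyp t"
  shows "hyp_pieces t' = hyp_pieces t"
  using hyp_eq_cases[OF assms]
proof
  assume "vq t' = vq t \<and> vr t' = vr t"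
  then show ?thesis by (simp only: hyp_pieces_def pt_hyp_reflected[of t' t])
next
  assume "vq t' = vr t \<and> vr t' = vq t"
  then have eq: "open_segment (pt t' 2 a) (pt t' 2 b) = open_segment (pt t 2 (3 - b)) (pt t 2 (3 - a))" for a b
    using open_segment_commute[of "pt t 2 (3 - b)"] by (simp only: pt_hyp_rotated[of t' t])
  show ?thesis unfolding hyp_pieces_def eq by (simp del: open_segment_eq) blast
qed

section \<open>How tiles of a patch meet\<close>

definition refine :: "frame set \<Rightarrow> frame set" where
  "refine F = (\<Union>t\<in>F. children t)"

text \<open>Relatively open sides and inner points of one tile are tested against the closed other
  tile, for ordered pairs. This rules out partial contacts as well as overlaps, and contacts of a
  leg with a hypotenuse.\<close>

definition well_matched :: "frame set \<Rightarrow> bool" where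
  "well_matched F \<longleftrightarrow> (\<forall>t\<in>F. nondeg t) \<and>
    (\<forall>t\<in>F. \<forall>t'\<in>F. t \<noteq> t' \<longrightarrow>
      inner_tile t' \<inter> tile_of t = {} \<and> marks t' \<inter> tile_of t \<subseteq> marks t \<and>
      (\<forall>X\<in>pieces t'. X \<inter> tile_of t \<noteq> {} \<longrightarrow> X \<in> pieces t) \<and>
      (hyp t' \<inter> tile_of t \<noteq> {} \<longrightarrow> hyp t' = hyp t))"

lemma well_matchedD:
  assumes "well_matched F" "t \<in> F"
  shows "nondeg t"
    and "t' \<in> F \<Longrightarrow> t \<noteq> t' \<Longrightarrow> inner_tile t' \<inter> tile_of t = {}"
    and "t' \<in> F \<Longrightarrow> marks t' \<inter> tile_of t \<subseteq> marks t"
    and "t' \<in> F \<Longrightarrow> X \<in> pieces t' \<Longrightarrow> X \<inter> tile_of t \<noteq> {} \<Longrightarrow> X \<in> pieces t"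
    and "t' \<in> F \<Longrightarrow> hyp t' \<inter> tile_of t \<noteq> {} \<Longrightarrow> hyp t' = hyp t"
  subgoal using assms unfolding well_matched_def by blast
  subgoal using assms unfolding well_matched_def by blast
  subgoal using assms unfolding well_matched_def by (cases "t = t'") blast+
  subgoal using assms unfolding well_matched_def by (cases "t = t'") blast+
  subgoal using assms unfolding well_matched_def by (cases "t = t'") blast+
  done

definition frame_size :: "frame \<Rightarrow> real" where
  "frame_size t = (case t of (p, u, v) \<Rightarrow> u \<bullet> u)"

text \<open>The coordinates are orthogonal with unit length \<open>sqrt (frame_size t / 5)\<close>:
  the direction (1, 0) is (2 u + v) / 5 and (0, 1) is (2 v - u) / 5.\<close>

lemma inner_pt_diff:
  assumes "nondeg t"
  shows "(pt t x y - pt t a b) \<bullet> (pt t x' y' - pt t a b) =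
    ((x - a) * (x' - a) + (y - b) * (y' - b)) / 5 * frame_size t"
proof -
  obtain p u v where t: "t = (p, u, v)" by (cases t)
  have uv: "u \<bullet> v = 0" "v \<bullet> u = 0" "v \<bullet> v = u \<bullet> u"
    using assms by (auto simp: nondeg_def t inner_commute)
  have diff: "pt t x y - pt t a b =
    ((2 * (x - a) - (y - b)) / 5) *\<^sub>R u + (((x - a) + 2 * (y - b)) / 5) *\<^sub>R v" for x y
    unfolding t pt_def by (simp add: prod_eq_iff field_simps)
  show ?thesis unfolding diff by (simp add: inner_add_left inner_add_right uv frame_size_def t field_simps)
qed

lemma nondeg_subframe:
  assumes "nondeg t" "fst b * fst c + snd b * snd c = 0"
    "fst b * fst b + snd b * snd b = 1" "fst c * fst c + snd c * snd c = 1"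
  shows "nondeg (subframe t a b c)" "frame_size (subframe t a b c) = frame_size t / 5"
proof -
  have pos: "frame_size t \<noteq> 0"
    using assms(1) by (auto simp: nondeg_def frame_size_def split: prod.splits)
  show "frame_size (subframe t a b c) = frame_size t / 5"
    using inner_pt_diff[OF assms(1), of "fst b" "snd b" 0 0 "fst b" "snd b"] assms(3)
    by (simp add: subframe_def frame_size_def)
  have "pt t (fst b) (snd b) \<noteq> pt t 0 0"
    using assms(3) by (auto simp: pt_eq_iff[OF assms(1)])
  then show "nondeg (subframe t a b c)"
    unfolding nondeg_def subframe_def
    using inner_pt_diff[OF assms(1), of "fst b" "snd b" 0 0 "fst b" "snd b"]
      inner_pt_diff[OF assms(1), of "fst c" "snd c" 0 0 "fst c" "snd c"]
      inner_pt_diff[OF assms(1), of "fst b" "snd b" 0 0 "fst c" "snd c"] assms(2-4)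
    by simp
qed

lemma child_subframe:
  assumes "nondeg t" "d \<in> children t"
  shows nondeg_child: "nondeg d" and frame_size_child: "frame_size d = frame_size t / 5"
  using assms(2)
  by (auto elim!: childE simp: chA_def chB_def chC_def chD_def chE_def nondeg_subframe[OF assms(1)])

text \<open>Children of different parents can touch only on the boundaries of the parents. A contact
  on a hypotenuse forces the parents to share all of it, so the cut points and unit pieces agree; a
  contact on a leg forces a common piece, which is the hypotenuse of both children.\<close>

lemma well_matched_refine:
  assumes W: "well_matched F"
  shows "well_matched (refine F)"
  unfolding well_matched_def
proof (intro conjI ballI impI)
  fix d assume "d \<in> refine F"
  then obtain t where t: "t \<in> F" "d \<in> children t" by (auto simp: refine_def)
  have nd: "nondeg t" using well_matchedD(1)[OF W] t by blast
  show "nondeg d" using nondeg_child nd t by blast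
  fix d' assume "d' \<in> refine F" "d \<noteq> d'"
  then obtain t' where t': "t' \<in> F" "d' \<in> children t'" by (auto simp: refine_def)
  have nd': "nondeg t'" using well_matchedD(1)[OF W] t' by blast
  have sub: "tile_of d \<subseteq> tile_of t" by (rule tile_of_child_subset[OF t(2)])
  have sub': "inner_tile d' \<subseteq> inner_tile t'" by (rule inner_tile_child_subset[OF t'(2)])
  have disj: "inner_tile t' \<inter> tile_of t = {}" if "t \<noteq> t'"
    using well_matchedD(2)[OF W t(1) t'(1) that] .
  show "inner_tile d' \<inter> tile_of d = {}"
  proof (cases "t = t'")
    case True
    then show ?thesis using children_inner_disjoint[OF nd t(2)] t' \<open>d \<noteq> d'\<close> by blast
  next
    case False
    then show ?thesis using disj sub sub' by blast
  qed
  \<comment> \<open>Any part of the hypotenuse of \<open>t'\<close> that touches a child of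
    \<open>t\<close> touches \<open>t\<close> itself.\<close>
  have hyp_same: "hyp t' = hyp t" if "X \<subseteq> hyp t'" "X \<inter> tile_of d \<noteq> {}" for X
    using well_matchedD(5)[OF W t(1) t'(1)] that sub by blast
  show "marks d' \<inter> tile_of d \<subseteq> marks d"
  proof (cases "t = t'")
    case True
    then show ?thesis using children_marks[OF nd t(2)] t' by blast
  next
    case False
    show ?thesis
    proof
      fix x assume x: "x \<in> marks d' \<inter> tile_of d"
      then consider "x \<in> marks t'" | "x \<in> hyp_points t'" | "x \<in> inner_tile t'"
        using marks_child_cases[OF t'(2)] by blast
      then show "x \<in> marks d"
      proof cases
        case 1
        then have "x \<in> marks t" using well_matchedD(3)[OF W t(1) t'(1)] x sub by blast
        then show ?thesis using parent_marks_child[OF nd t(2)] x by (auto simp: marks_def corners_def)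
      next
        case 2
        then have "hyp t' = hyp t" using hyp_same[of "{x}"] hyp_points_subset[OF nd'] x by blast
        then have "x \<in> hyp_points t" using 2 hyp_points_cong[OF nd] by blast
        then show ?thesis using hyp_points_child[OF nd t(2)] x by blast
      next
        case 3
        then show ?thesis using disj False x sub by blast
      qed
    qed
  qed
  show "X \<in> pieces d" if X: "X \<in> pieces d'" "X \<inter> tile_of d \<noteq> {}" for X
  proof (cases "t = t'")
    case True
    then show ?thesis using children_pieces[OF nd t(2)] t' X by blast
  next
    case False
    then have "\<not> X \<subseteq> inner_tile t'" using disj X sub by blast
    then have X': "X \<in> hyp_pieces t'" using pieces_child_cases[OF t'(2) X(1)] by blast
    then have "hyp t' = hyp t" using hyp_same[of X] hyp_pieces_subset[OF nd'] X by blast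
    then have "X \<in> hyp_pieces t" using X' hyp_pieces_cong[OF nd] by blast
    then show ?thesis using hyp_pieces_child[OF nd t(2)] X by blast
  qed
  show "hyp d' = hyp d" if H: "hyp d' \<inter> tile_of d \<noteq> {}"
  proof (cases "t = t'")
    case True
    then show ?thesis using children_hyp[OF nd t(2)] t' H by blast
  next
    case False
    then have "\<not> hyp d' \<subseteq> inner_tile t'" using disj H sub by blast
    then have "hyp d' \<in> pieces t'" using hyp_child_cases[OF t'(2)] by blast
    then have "hyp d' \<in> pieces t" using well_matchedD(4)[OF W t(1) t'(1)] H sub by blast
    then show ?thesis using parent_pieces_child[OF nd t(2)] H by blast
  qed
qed

section \<open>Parity of vertices\<close>

text \<open>Clearing denominators multiplies by a power of 5, which is odd and preserves the parity.\<close>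

definition grid :: "bool \<Rightarrow> plane \<Rightarrow> bool" where
  "grid b z \<longleftrightarrow> (\<exists>k a c. 5 ^ k * fst z = of_int a \<and> 5 ^ k * snd z = of_int c \<and> (even (a + c) \<longleftrightarrow> b))"

text \<open>Two representations with denominators 5^k and 5^l become equal after multiplication by
  odd numbers, which does not change parity.\<close>

lemma grid_unique:
  assumes "grid b z" "grid b' z"
  shows "b = b'"
proof -
  obtain k a c where 1: "5 ^ k * fst z = of_int a" "5 ^ k * snd z = of_int c" "even (a + c) \<longleftrightarrow> b"
    using assms(1) unfolding grid_def by blast
  obtain l a' c' where 2: "5 ^ l * fst z = of_int a'" "5 ^ l * snd z = of_int c'" "even (a' + c') \<longleftrightarrow> b'"
    using assms(2) unfolding grid_def by blast
  have "real_of_int (5 ^ l * (a + c)) = 5 ^ l * (5 ^ k * fst z + 5 ^ k * snd z)" using 1 by simp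
  also have "\<dots> = 5 ^ k * (5 ^ l * fst z + 5 ^ l * snd z)" by (simp add: algebra_simps)
  also have "\<dots> = real_of_int (5 ^ k * (a' + c'))" using 2 by simp
  finally have "5 ^ l * (a + c) = 5 ^ k * (a' + c')" by (simp only: of_int_eq_iff)
  then have "even (5 ^ l * (a + c)) = even (5 ^ k * (a' + c'))" by simp
  then show ?thesis using 1(3) 2(3) by simp
qed

text \<open>With \<open>True\<close> standing for even, \<open>b = b'\<close> is the sum of the two
  parities.\<close>

lemma grid_add:
  assumes "grid b y" "grid b' z"
  shows "grid (b = b') (y + z)"
proof -
  obtain k a c where 1: "5 ^ k * fst y = of_int a" "5 ^ k * snd y = of_int c" "even (a + c) \<longleftrightarrow> b"
    using assms(1) unfolding grid_def by blast
  obtain l a' c' where 2: "5 ^ l * fst z = of_int a'" "5 ^ l * snd z = of_int c'" "even (a' + c') \<longleftrightarrow> b'"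
    using assms(2) unfolding grid_def by blast
  have "5 ^ (k + l) * fst (y + z) = 5 ^ l * (5 ^ k * fst y) + 5 ^ k * (5 ^ l * fst z)"
    "5 ^ (k + l) * snd (y + z) = 5 ^ l * (5 ^ k * snd y) + 5 ^ k * (5 ^ l * snd z)"
    by (simp_all add: power_add algebra_simps)
  then have "5 ^ (k + l) * fst (y + z) = of_int (5 ^ l * a + 5 ^ k * a')"
    "5 ^ (k + l) * snd (y + z) = of_int (5 ^ l * c + 5 ^ k * c')"
    using 1 2 by simp_all
  moreover have "even ((5 ^ l * a + 5 ^ k * a') + (5 ^ l * c + 5 ^ k * c')) \<longleftrightarrow> (b = b')"
    using 1(3) 2(3) by auto
  ultimately show ?thesis unfolding grid_def by blast
qed

lemma grid_scaleR:
  assumes "grid b z"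
  shows "grid (even m \<or> b) ((of_int m / 5) *\<^sub>R z)"
proof -
  obtain k a c where 1: "5 ^ k * fst z = of_int a" "5 ^ k * snd z = of_int c" "even (a + c) \<longleftrightarrow> b"
    using assms(1) unfolding grid_def by blast
  have "5 ^ Suc k * fst ((of_int m / 5) *\<^sub>R z) = of_int m * (5 ^ k * fst z)"
    "5 ^ Suc k * snd ((of_int m / 5) *\<^sub>R z) = of_int m * (5 ^ k * snd z)" by simp_all
  then have "5 ^ Suc k * fst ((of_int m / 5) *\<^sub>R z) = of_int (m * a)"
    "5 ^ Suc k * snd ((of_int m / 5) *\<^sub>R z) = of_int (m * c)"
    using 1 by simp_all
  moreover have "even (m * a + m * c) \<longleftrightarrow> even m \<or> b"
    using 1(3) by auto
  ultimately show ?thesis unfolding grid_def by blast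
qed

definition grid_frame :: "frame \<Rightarrow> bool" where
  "grid_frame t \<longleftrightarrow> (case t of (p, u, v) \<Rightarrow> (\<exists>b. grid b p) \<and> grid False u \<and> grid False v)"

text \<open>Both leg vectors of a grid frame are odd, and the coefficients satisfy (2 x - y) + (x +
  2 y) = 3 x + y, which has the parity of x + y.\<close>

lemma grid_pt:
  assumes "grid_frame t" "grid b (fst t)"
  shows "grid (b = even (x + y)) (pt t (of_int x) (of_int y))"
proof -
  obtain p u v where t: "t = (p, u, v)" by (cases t)
  have "grid ((b = (even (2 * x - y) \<or> False)) = (even (x + 2 * y) \<or> False))
    (p + (of_int (2 * x - y) / 5) *\<^sub>R u + (of_int (x + 2 * y) / 5) *\<^sub>R v)"
    using assms by (intro grid_add grid_scaleR) (auto simp: t grid_frame_def)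
  also have "((b = (even (2 * x - y) \<or> False)) = (even (x + 2 * y) \<or> False)) = (b = even (x + y))"
    by auto
  finally show ?thesis by (simp add: t pt_def)
qed

lemma grid_frame_subframe:
  assumes "grid_frame t" "odd (b1 + b2)" "odd (c1 + c2)"
  shows "grid_frame (subframe t (of_int a1, of_int a2) (of_int b1, of_int b2) (of_int c1, of_int c2))"
proof -
  obtain p u v where t: "t = (p, u, v)" by (cases t)
  have *: "grid False (pt t (of_int x) (of_int y) - pt t 0 0)" if "odd (x + y)" for x y :: int
  proof -
    have "grid ((even (2 * x - y) \<or> False) = (even (x + 2 * y) \<or> False))
      ((of_int (2 * x - y) / 5) *\<^sub>R u + (of_int (x + 2 * y) / 5) *\<^sub>R v)"
      using assms by (intro grid_add grid_scaleR) (auto simp: t grid_frame_def)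
    also have "((even (2 * x - y) \<or> False) = (even (x + 2 * y) \<or> False)) = False"
      using that by auto
    finally show ?thesis by (simp add: t pt_def)
  qed
  obtain b where "grid b p" using assms(1) by (auto simp: grid_frame_def t)
  then have "grid (b = even (a1 + a2)) (pt t (of_int a1) (of_int a2))"
    by (intro grid_pt assms) (simp add: t)
  then show ?thesis using *[OF assms(2)] *[OF assms(3)]
    unfolding grid_frame_def subframe_def by auto
qed

lemma grid_frame_child:
  assumes "grid_frame t" "d \<in> children t"
  shows "grid_frame d"
proof -
  note * = grid_frame_subframe[OF assms(1)]
  have "grid_frame (chA t)" using *[of 0 "- 1" "- 1" 0 2 0] by (simp add: chA_def)
  moreover have "grid_frame (chB t)" using *[of "- 1" 0 0 1 1 0] by (simp add: chB_def)
  moreover have "grid_frame (chC t)" using *[of "- 1" 0 0 1 2 0] by (simp add: chC_def)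
  moreover have "grid_frame (chD t)" using *[of 1 0 0 "- 1" 1 2] by (simp add: chD_def)
  moreover have "grid_frame (chE t)" using *[of "- 1" 0 0 1 2 2] by (simp add: chE_def)
  ultimately show ?thesis using assms(2) by (auto simp: children_def)
qed

lemma grid_True_pt:
  assumes "grid_frame t"
  shows "grid True (pt t (of_int x) (of_int y)) \<longleftrightarrow> (grid True (vp t) \<longleftrightarrow> even (x + y))"
proof -
  obtain b where b: "grid b (fst t)" using assms by (auto simp: grid_frame_def)
  have "vp t = fst t" by (auto simp: vp_def pt_def split: prod.split)
  then have 1: "grid True (vp t) = b" using b grid_unique by metis
  have "grid (b = even (x + y)) (pt t (of_int x) (of_int y))" by (rule grid_pt[OF assms b])
  then have "grid True (pt t (of_int x) (of_int y)) \<longleftrightarrow> (b = even (x + y))" using grid_unique by metis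
  then show ?thesis using 1 by simp
qed

section \<open>Colouring the patches\<close>

definition all_marks :: "frame set \<Rightarrow> plane set" where "all_marks F = (\<Union>t\<in>F. marks t)"
definition all_corners :: "frame set \<Rightarrow> plane set" where "all_corners F = (\<Union>t\<in>F. corners t)"

text \<open>For different tiles of a matched patch, this is a half-turn about the midpoint of the
  common hypotenuse, and \<open>reflected_neighbour\<close> is the reflection in it. The latter also
  relates a tile to itself.\<close>

definition rotated_neighbour :: "frame \<Rightarrow> frame \<Rightarrow> bool" where
  "rotated_neighbour t t' \<longleftrightarrow> vq t' = vr t \<and> vr t' = vq t"

definition reflected_neighbour :: "frame \<Rightarrow> frame \<Rightarrow> bool" where
  "reflected_neighbour t t' \<longleftrightarrow> vq t' = vq t \<and> vr t' = vr t"

text \<open>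
  These conditions on the colours of the corners and long-leg midpoints are what is needed to
  extend a colouring of \<open>F\<close> to a proper colouring of \<open>refine F\<close>.
\<close>

definition preparatory :: "frame set \<Rightarrow> (plane \<Rightarrow> nat) \<Rightarrow> bool" where
  "preparatory F c \<longleftrightarrow> (\<forall>z. c z < 3) \<and>
    (\<forall>t\<in>F. c (vq t) \<noteq> c (vp t) \<and> c (vm t) \<noteq> c (vp t) \<and> c (vm t) \<noteq> c (vr t) \<and>
      ((\<nexists>t'. t' \<in> F \<and> rotated_neighbour t t') \<longrightarrow> c (vq t) = c (vr t)) \<and>
      (\<forall>t'\<in>F. rotated_neighbour t t' \<longrightarrow> c (vp t) \<noteq> c (vp t')) \<and>
      (\<forall>t'\<in>F. reflected_neighbour t t' \<longrightarrow> c (vp t) = c (vp t')))"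

definition parity_colour :: "frame set \<Rightarrow> plane \<Rightarrow> nat" where
  "parity_colour F z = (if z \<in> all_marks F then 0 else if grid True z then 1 else 2)"

lemma pt_in_tile: "x \<le> 2 \<Longrightarrow> 0 \<le> x + 2 * y \<Longrightarrow> y \<le> 2 * x \<Longrightarrow> pt t x y \<in> tile_of t"
  unfolding tile_of_def by blast

lemma pt_in_inner: "x < 2 \<Longrightarrow> 0 < x + 2 * y \<Longrightarrow> y < 2 * x \<Longrightarrow> pt t x y \<in> inner_tile t"
  unfolding inner_tile_def by blast

lemma marks_subset_tile: "marks t \<subseteq> tile_of t"
  by (auto simp: marks_def vp_def vq_def vr_def vm_def intro: pt_in_tile)

lemma corners_subset_marks: "corners t \<subseteq> marks t"
  by (auto simp: marks_def corners_def)

lemma all_marks_tile: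
  assumes "well_matched F" "t \<in> F" "z \<in> tile_of t"
  shows "z \<in> all_marks F \<longleftrightarrow> z \<in> marks t"
  using assms well_matchedD(3)[OF assms(1,2)] unfolding all_marks_def by blast

lemma marks_pt_iff:
  assumes "nondeg t"
  shows "pt t x y \<in> marks t \<longleftrightarrow> (x = 0 \<and> y = 0) \<or> (x = 2 \<and> y = - 1) \<or> (x = 2 \<and> y = 4) \<or> (x = 1 \<and> y = 2)"
  by (auto simp: marks_def vp_def vq_def vr_def vm_def pt_eq_iff[OF assms])

lemma parity_colour_pt:
  assumes W: "well_matched F" and G: "\<forall>t\<in>F. grid_frame t" and t: "t \<in> F"
  shows "parity_colour F (pt t 0 0) = 0" "parity_colour F (pt t 2 (- 1)) = 0"
    "parity_colour F (pt t 2 4) = 0" "parity_colour F (pt t 1 2) = 0"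
    "parity_colour F (pt t 2 0) = (if grid True (vp t) then 1 else 2)"
    "parity_colour F (pt t 2 1) = (if grid True (vp t) then 2 else 1)"
    "parity_colour F (pt t 2 2) = (if grid True (vp t) then 1 else 2)"
    "parity_colour F (pt t 2 3) = (if grid True (vp t) then 2 else 1)"
    "parity_colour F (pt t 1 0) = (if grid True (vp t) then 2 else 1)"
    "parity_colour F (pt t 1 1) = (if grid True (vp t) then 1 else 2)"
proof -
  note nd = well_matchedD(1)[OF W t]
  have g: "grid True (pt t (of_int x) (of_int y)) \<longleftrightarrow> (grid True (vp t) \<longleftrightarrow> even (x + y))" for x y
    using grid_True_pt G t by blast
  have g': "grid True (pt t 2 0) \<longleftrightarrow> grid True (vp t)" "grid True (pt t 2 1) \<longleftrightarrow> \<not> grid True (vp t)"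
    "grid True (pt t 2 2) \<longleftrightarrow> grid True (vp t)" "grid True (pt t 2 3) \<longleftrightarrow> \<not> grid True (vp t)"
    "grid True (pt t 1 0) \<longleftrightarrow> \<not> grid True (vp t)" "grid True (pt t 1 1) \<longleftrightarrow> grid True (vp t)"
    using g[of 2 0] g[of 2 1] g[of 2 2] g[of 2 3] g[of 1 0] g[of 1 1] by simp_all
  have *: "parity_colour F (pt t x y) = (if pt t x y \<in> marks t then 0 else if grid True (pt t x y) then 1 else 2)"
    if "x \<le> 2" "0 \<le> x + 2 * y" "y \<le> 2 * x" for x y
    using all_marks_tile[OF W t pt_in_tile[OF that]] by (simp add: parity_colour_def)
  show "parity_colour F (pt t 0 0) = 0" "parity_colour F (pt t 2 (- 1)) = 0"
    "parity_colour F (pt t 2 4) = 0" "parity_colour F (pt t 1 2) = 0"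
    "parity_colour F (pt t 2 0) = (if grid True (vp t) then 1 else 2)"
    "parity_colour F (pt t 2 1) = (if grid True (vp t) then 2 else 1)"
    "parity_colour F (pt t 2 2) = (if grid True (vp t) then 1 else 2)"
    "parity_colour F (pt t 2 3) = (if grid True (vp t) then 2 else 1)"
    "parity_colour F (pt t 1 0) = (if grid True (vp t) then 2 else 1)"
    "parity_colour F (pt t 1 1) = (if grid True (vp t) then 1 else 2)"
    by (simp_all add: * marks_pt_iff[OF nd] g')
qed

text \<open>The short leg is an odd vector, while the long leg is twice a grid vector.\<close>

lemma grid_frame_corners:
  assumes "grid_frame t"
  shows "grid True (vq t) \<longleftrightarrow> \<not> grid True (vp t)" "grid True (vr t) \<longleftrightarrow> grid True (vp t)"
  using grid_True_pt[OF assms, of 2 "- 1"] grid_True_pt[OF assms, of 2 4] by (simp_all add: vq_def vr_def)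

text \<open>The hypotenuses of A, B, E end at marks of the parent, so both ends get colour 0; their
  right angles and midpoints get 1 and 2. The children C and D are rotated neighbours of each other,
  and only D has its right angle at a mark.\<close>

lemma preparatory_parity_colour:
  assumes W: "well_matched F" and G: "\<forall>t\<in>F. grid_frame t"
  shows "preparatory (refine F) (parity_colour F)"
  unfolding preparatory_def
proof (intro conjI allI ballI impI)
  let ?c = "parity_colour F"
  show "?c z < 3" for z by (simp add: parity_colour_def)
  fix d assume d: "d \<in> refine F"
  then obtain t where t: "t \<in> F" "d \<in> children t" by (auto simp: refine_def)
  note nd = well_matchedD(1)[OF W t(1)]
  note pc = parity_colour_pt[OF W G t(1)]
  show "?c (vq d) \<noteq> ?c (vp d)" "?c (vm d) \<noteq> ?c (vp d)" "?c (vm d) \<noteq> ?c (vr d)"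
    using t(2) by (auto elim!: childE simp: child_points pc split: if_splits)
  have CD: "rotated_neighbour (chC t) (chD t)" "rotated_neighbour (chD t) (chC t)"
    by (simp_all add: rotated_neighbour_def child_points)
  have kids: "chC t \<in> refine F" "chD t \<in> refine F"
    using t(1) by (auto simp: refine_def children_def)
  show "?c (vq d) = ?c (vr d)" if "\<nexists>d'. d' \<in> refine F \<and> rotated_neighbour d d'"
  proof -
    have "d \<noteq> chC t" "d \<noteq> chD t" using that CD kids by blast+
    then show ?thesis using t(2) by (auto elim!: childE simp: child_points pc)
  qed
  fix d' assume d': "d' \<in> refine F"
  then obtain t' where t': "t' \<in> F" "d' \<in> children t'" by (auto simp: refine_def)
  note nd' = well_matchedD(1)[OF W t'(1)]
  note pc' = parity_colour_pt[OF W G t'(1)]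
  have in_t': "vq d' \<in> tile_of t'" "vr d' \<in> tile_of t'"
    using marks_subset_tile[of d'] tile_of_child_subset[OF t'(2)] by (auto simp: marks_def)
  have in_t: "vq d \<in> tile_of t" "vr d \<in> tile_of t"
    using marks_subset_tile[of d] tile_of_child_subset[OF t(2)] by (auto simp: marks_def)
  have I: "pt t 1 0 \<in> inner_tile t" "pt t' 1 0 \<in> inner_tile t'" by (auto intro: pt_in_inner)
  \<comment> \<open>The hypotenuse of C and D ends at (1, 0), an inner point of the parent, and so
    cannot be shared with a child of another tile.\<close>
  have outer: "d \<in> {chA t, chB t, chE t} \<and> d' \<in> {chA t', chB t', chE t'}"
    if "t \<noteq> t'" "{vq d, vr d} = {vq d', vr d'}"
  proof -
    have "{vq d, vr d} \<subseteq> tile_of t'" unfolding that(2) using in_t' by simp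
    moreover have "{vq d', vr d'} \<subseteq> tile_of t" unfolding that(2)[symmetric] using in_t by simp
    ultimately have "pt t 1 0 \<notin> {vq d, vr d}" "pt t' 1 0 \<notin> {vq d', vr d'}"
      using I well_matchedD(2)[OF W t(1) t'(1) that(1)]
        well_matchedD(2)[OF W t'(1) t(1) that(1)[symmetric]] by blast+
    then have "d \<noteq> chC t \<and> d \<noteq> chD t" "d' \<noteq> chC t' \<and> d' \<noteq> chD t'"
      by (auto simp: child_points)
    then show ?thesis using t(2) t'(2) by (simp add: children_def)
  qed
  have gd: "grid_frame d" "grid_frame d'" using grid_frame_child G t t' by blast+
  \<comment> \<open>Only the child D has a right angle coloured 0, so elsewhere the parities decide.\<close>
  have par: "?c (vp e) = (if grid True (vp e) then 1 else 2)"
    if "s \<in> F" "e \<in> {chA s, chB s, chE s}" for e s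
  proof -
    have "vp e \<in> tile_of s" "vp e \<notin> marks s"
      using that(2) well_matchedD(1)[OF W that(1)] by (auto simp: child_points marks_pt_iff intro!: pt_in_tile)
    then show ?thesis using all_marks_tile[OF W that(1)] by (simp add: parity_colour_def)
  qed
  show "?c (vp d) \<noteq> ?c (vp d')" if rot: "rotated_neighbour d d'"
  proof (cases "t = t'")
    case True
    then show ?thesis using t(2) t'(2) rot
      by (auto elim!: childE simp: rotated_neighbour_def child_points pt_eq_iff[OF nd'] pc' split: if_splits)
  next
    case False
    then have "d \<in> {chA t, chB t, chE t} \<and> d' \<in> {chA t', chB t', chE t'}"
      using outer rot by (auto simp: rotated_neighbour_def)
    \<comment> \<open>A right angle has the parity of the far end of its long leg and the opposite
      parity to the far end of its short leg; the rotation exchanges these ends.\<close>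
    moreover have "grid True (vp d) \<longleftrightarrow> \<not> grid True (vp d')"
      using rot grid_frame_corners[OF gd(1)] grid_frame_corners[OF gd(2)] by (auto simp: rotated_neighbour_def)
    ultimately show ?thesis using par t(1) t'(1) by auto
  qed
  show "?c (vp d) = ?c (vp d')" if refl: "reflected_neighbour d d'"
  proof (cases "t = t'")
    case True
    then show ?thesis using t(2) t'(2) refl
      by (auto elim!: childE simp: reflected_neighbour_def child_points pt_eq_iff[OF nd'])
  next
    case False
    then have "d \<in> {chA t, chB t, chE t} \<and> d' \<in> {chA t', chB t', chE t'}"
      using outer refl by (auto simp: reflected_neighbour_def)
    moreover have "grid True (vp d) \<longleftrightarrow> grid True (vp d')"
      using refl grid_frame_corners[OF gd(1)] grid_frame_corners[OF gd(2)] by (auto simp: reflected_neighbour_def)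
    ultimately show ?thesis using par t(1) t'(1) by auto
  qed
qed

text \<open>
  The extension of \<open>c\<close> to the new points \<open>(1, 0)\<close>, \<open>(2, 2)\<close>, \<open>(2, 0)\<close> of the tile \<open>t\<close>;
  \<open>3 - a - b\<close> is the colour different from the colours \<open>a \<noteq> b\<close>. If a rotated tile shares the
  hypotenuse, then its new points separate \<open>(2, 0)\<close> from \<open>(2, 2)\<close>, which may then be coloured alike.
\<close>

definition assigns :: "frame set \<Rightarrow> (plane \<Rightarrow> nat) \<Rightarrow> frame \<Rightarrow> plane \<Rightarrow> nat \<Rightarrow> bool" where
  "assigns F c t z k \<longleftrightarrow>
    z \<in> marks t \<and> k = c z \<or>
    z = pt t 1 0 \<and> k = 3 - c (vp t) - c (vm t) \<or>
    z = pt t 2 2 \<and> k = c (vp t) \<or>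
    z = pt t 2 0 \<and> k = (if \<exists>t'\<in>F. rotated_neighbour t t' then c (vp t) else 3 - c (vp t) - c (vq t))"

lemma neighbour_cases:
  assumes "well_matched F" "t \<in> F" "t' \<in> F" "z = pt t' 2 y" "- 1 < y" "y < 4" "z \<in> tile_of t"
  shows "reflected_neighbour t t' \<and> z = pt t 2 y \<or> rotated_neighbour t t' \<and> z = pt t 2 (3 - y)"
proof -
  have "z \<in> hyp t'" using pt_hyp_inner[OF well_matchedD(1)[OF assms(1,3)]] assms by blast
  then have "hyp t' = hyp t" using well_matchedD(5)[OF assms(1-3)] assms(7) by blast
  then show ?thesis
    using hyp_eq_cases[OF well_matchedD(1)[OF assms(1,2)]] pt_hyp_reflected[of t' t y] pt_hyp_rotated[of t' t y] assms(4)
    unfolding reflected_neighbour_def rotated_neighbour_def by metis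
qed

text \<open>A new point is shared by two tiles only on a common hypotenuse. New points of a rotated
  tile fall on y = 1 and y = 3, away from (2, 0) and (2, 2), so only a reflected tile can compete,
  and then all the colours used agree.\<close>

lemma assigns_unique:
  assumes W: "well_matched F" and P: "preparatory F c" and t: "t \<in> F" "t' \<in> F"
    and a: "assigns F c t z k" "assigns F c t' z k'"
  shows "k = k'"
proof -
  note nd = well_matchedD(1)[OF W t(1)] and nd' = well_matchedD(1)[OF W t(2)]
  have outside: "pt s 1 0 \<notin> marks s" "pt s 2 2 \<notin> marks s" "pt s 2 0 \<notin> marks s"
    "pt s 1 0 \<noteq> pt s 2 2" "pt s 1 0 \<noteq> pt s 2 0" "pt s 2 2 \<noteq> pt s 2 0"
    if "nondeg s" for s
    by (simp_all add: marks_pt_iff[OF that] pt_eq_iff[OF that])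
  have in_tile: "z \<in> tile_of s" if "assigns F c s z l" for s l
    using that marks_subset_tile[of s] by (auto simp: assigns_def intro: pt_in_tile)
  show ?thesis
  proof (cases "t = t'")
    case True
    show ?thesis using a outside[OF nd] unfolding True assigns_def by auto
  next
    case False
    have "pt t 1 0 \<notin> tile_of t'" "pt t' 1 0 \<notin> tile_of t"
      using well_matchedD(2)[OF W t False] well_matchedD(2)[OF W t(2,1) False[symmetric]]
        pt_in_inner[of 1 0 t] pt_in_inner[of 1 0 t'] by auto
    then have I: "z \<noteq> pt t 1 0" "z \<noteq> pt t' 1 0" using in_tile a by blast+
    have m: "z \<in> marks t \<longleftrightarrow> z \<in> marks t'"
      using well_matchedD(3)[OF W t] well_matchedD(3)[OF W t(2,1)] in_tile[OF a(1)] in_tile[OF a(2)] by blast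
    show ?thesis
    proof (cases "z \<in> marks t")
      case True
      then show ?thesis using a m outside[OF nd] outside[OF nd'] unfolding assigns_def by auto
    next
      case no: False
      obtain y where y: "y = 0 \<or> y = 2" "z = pt t' 2 y"
        using a(2) no m I unfolding assigns_def by blast
      have z: "z = pt t 2 2 \<or> z = pt t 2 0" using a(1) no I unfolding assigns_def by blast
      have "reflected_neighbour t t' \<and> z = pt t 2 y \<or> rotated_neighbour t t' \<and> z = pt t 2 (3 - y)"
        by (rule neighbour_cases[OF W t y(2)]) (use y in_tile[OF a(1)] in auto)
      \<comment> \<open>Rotation would send y = 0 or 2 to 3 or 1, whereas \<open>z\<close> is at
        height 0 or 2 in both tiles.\<close>
      then have refl: "reflected_neighbour t t'" and zy: "z = pt t 2 y"
        using z y(1) by (auto simp: pt_eq_iff[OF nd])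
      have *: "l = (if y = 2 then c (vp s) else
          if \<exists>t'\<in>F. rotated_neighbour s t' then c (vp s) else 3 - c (vp s) - c (vq s))"
        if "nondeg s" "assigns F c s (pt s 2 y) l" for s l
        using that(2) outside[OF that(1)] y(1) unfolding assigns_def by (elim disjE conjE) simp_all
      have "assigns F c t (pt t 2 y) k" "assigns F c t' (pt t' 2 y) k'"
        using a zy y(2) by simp_all
      note colours = *[OF nd this(1)] *[OF nd' this(2)]
      have "c (vp t) = c (vp t')" using P t refl by (simp add: preparatory_def)
      moreover have "c (vq t) = c (vq t')"
        "(\<exists>s\<in>F. rotated_neighbour t s) \<longleftrightarrow> (\<exists>s\<in>F. rotated_neighbour t' s)"
        using refl by (simp_all add: reflected_neighbour_def rotated_neighbour_def)
      ultimately show ?thesis using colours by simp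
    qed
  qed
qed

text \<open>The default 0 is used at points that receive no colour and keeps all values below
  3.\<close>

definition refined_colour :: "frame set \<Rightarrow> (plane \<Rightarrow> nat) \<Rightarrow> plane \<Rightarrow> nat" where
  "refined_colour F c z = (if \<exists>t\<in>F. \<exists>k. assigns F c t z k then SOME k. \<exists>t\<in>F. assigns F c t z k else 0)"

lemma refined_colour_eq:
  assumes "well_matched F" "preparatory F c" "t \<in> F" "assigns F c t z k"
  shows "refined_colour F c z = k"
proof -
  have "(SOME k. \<exists>t\<in>F. assigns F c t z k) = k"
    by (rule some_equality) (use assms assigns_unique[OF assms(1,2)] in blast)+
  then show ?thesis using assms unfolding refined_colour_def by auto
qed

lemma refined_colour_less:
  assumes "preparatory F c"
  shows "refined_colour F c z < 3"
proof (cases "\<exists>t\<in>F. \<exists>k. assigns F c t z k")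
  case True
  have "k < 3" if "t \<in> F" "assigns F c t z k" for t k
  proof -
    have "c (vp t) < 3" "c (vq t) \<noteq> c (vp t)" "c (vm t) \<noteq> c (vp t)" "c (vp t) < 3" "c z < 3"
      using assms that(1) unfolding preparatory_def by blast+
    then show ?thesis using that(2) by (auto simp: assigns_def)
  qed
  moreover have "\<exists>t\<in>F. assigns F c t z (SOME k. \<exists>t\<in>F. assigns F c t z k)"
    using True someI_ex[of "\<lambda>k. \<exists>t\<in>F. assigns F c t z k"] by blast
  ultimately show ?thesis using True unfolding refined_colour_def by auto
qed (simp add: refined_colour_def)

text \<open>The points (2, 1) and (2, 3) are the points (2, 2) and (2, 0) of a rotated tile across
  the hypotenuse; nothing else can add a corner to \<open>t\<close>.\<close>

lemma refined_corner_cases: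
  assumes W: "well_matched F" and t: "t \<in> F" and z: "z \<in> tile_of t" "z \<in> all_corners (refine F)"
  shows "z \<in> marks t \<or> z \<in> {pt t 1 0, pt t 2 0, pt t 2 2} \<or>
    (\<exists>t'\<in>F. rotated_neighbour t t' \<and> (z = pt t 2 1 \<or> z = pt t 2 3))"
proof -
  obtain t' d where t': "t' \<in> F" "d \<in> children t'" "z \<in> corners d"
    using z(2) by (auto simp: all_corners_def refine_def)
  have zc: "z \<in> marks t' \<or> z = pt t' 1 0 \<or> z = pt t' 2 0 \<or> z = pt t' 2 2"
    using t'(2,3) by (auto elim!: childE simp: corners_def child_points marks_def vp_def[of t'] vq_def[of t'] vr_def[of t'] vm_def[of t'])
  show ?thesis
  proof (cases "t = t'")
    case True
    then show ?thesis using zc by blast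
  next
    case False
    have "pt t' 1 0 \<notin> tile_of t"
      using well_matchedD(2)[OF W t t'(1) False] pt_in_inner[of 1 0 t'] by auto
    then consider "z \<in> marks t'" | y where "y = 0 \<or> y = 2" "z = pt t' 2 y" using zc z(1) by blast
    then show ?thesis
    proof cases
      case 1
      then show ?thesis using well_matchedD(3)[OF W t t'(1)] z by blast
    next
      case 2
      then have "reflected_neighbour t t' \<and> z = pt t 2 y \<or> rotated_neighbour t t' \<and> z = pt t 2 (3 - y)"
        using neighbour_cases[OF W t t'(1) 2(2)] z by auto
      then show ?thesis using 2(1) t'(1) by auto
    qed
  qed
qed

text \<open>In a matched patch the long leg is the only side that may be subdivided, and only at its
  midpoint; the case split lists the resulting edges.\<close>

definition proper_on :: "frame set \<Rightarrow> (plane \<Rightarrow> nat) \<Rightarrow> bool" where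
  "proper_on F c \<longleftrightarrow> (\<forall>t\<in>F. c (vp t) \<noteq> c (vq t) \<and> c (vq t) \<noteq> c (vr t) \<and>
    (if vm t \<in> all_corners F then c (vp t) \<noteq> c (vm t) \<and> c (vm t) \<noteq> c (vr t) else c (vp t) \<noteq> c (vr t)))"

lemma third_colour:
  fixes x y z :: nat
  assumes "x < 3" "y < 3" "y \<noteq> x"
  shows "3 - x - y \<noteq> x" "3 - x - y \<noteq> y"
    and "z < 3 \<Longrightarrow> z \<noteq> x \<Longrightarrow> y \<noteq> z \<Longrightarrow> 3 - x - y \<noteq> 3 - x - z"
  subgoal using assms by arith
  subgoal using assms by arith
  subgoal using assms by arith
  done

lemma proper_on_refined_colour:
  assumes W: "well_matched F" and P: "preparatory F c"
  shows "proper_on (refine F) (refined_colour F c)"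
  unfolding proper_on_def
proof
  let ?c = "refined_colour F c"
  fix d assume "d \<in> refine F"
  then obtain t where t: "t \<in> F" "d \<in> children t" by (auto simp: refine_def)
  note nd = well_matchedD(1)[OF W t(1)]
  note eq = refined_colour_eq[OF W P]
  have base: "?c (pt s 0 0) = c (vp s)" "?c (pt s 2 (- 1)) = c (vq s)" "?c (pt s 2 4) = c (vr s)"
    "?c (pt s 1 2) = c (vm s)" "?c (pt s 1 0) = 3 - c (vp s) - c (vm s)" "?c (pt s 2 2) = c (vp s)"
    "?c (pt s 2 0) = (if \<exists>t'\<in>F. rotated_neighbour s t' then c (vp s) else 3 - c (vp s) - c (vq s))"
    if "s \<in> F" for s
    by (rule eq[OF that], simp add: assigns_def marks_def vp_def vq_def vr_def vm_def)+
  have less: "c z < 3" for z using P unfolding preparatory_def by blast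
  have prep: "c (vq t) \<noteq> c (vp t)" "c (vm t) \<noteq> c (vp t)" "c (vm t) \<noteq> c (vr t)"
    "(\<nexists>t'. t' \<in> F \<and> rotated_neighbour t t') \<Longrightarrow> c (vq t) = c (vr t)"
    "\<And>t'. t' \<in> F \<Longrightarrow> rotated_neighbour t t' \<Longrightarrow> c (vp t) \<noteq> c (vp t')"
    using P t(1) by (simp_all add: preparatory_def)
  have bounds: "c (vp t) < 3" "c (vq t) < 3" "c (vr t) < 3" "c (vm t) < 3" using less by auto
  define i where "i = 3 - c (vp t) - c (vm t)"
  define h where "h = 3 - c (vp t) - c (vq t)"
  \<comment> \<open>The last inequality separates (2, 0) from (1, 0) if there is no rotated tile:
    then \<open>c (vq t) = c (vr t)\<close>, which differs from \<open>c (vm t)\<close>.\<close>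
  have i: "i \<noteq> c (vp t)" "i \<noteq> c (vm t)" and h: "h \<noteq> c (vp t)" "h \<noteq> c (vq t)" "c (vq t) \<noteq> c (vm t) \<Longrightarrow> h \<noteq> i"
    using third_colour[of "c (vp t)" "c (vq t)"] third_colour[of "c (vp t)" "c (vm t)"] prep(1,2) bounds
    unfolding i_def h_def by (metis, metis, metis, metis, metis)
  note base_t = base[OF t(1), folded i_def h_def]
  have corner: "pt t 1 0 \<in> all_corners (refine F)"
  proof -
    have "chB t \<in> refine F" "pt t 1 0 \<in> corners (chB t)"
      using t(1) by (auto simp: refine_def children_def corners_def child_points)
    then show ?thesis unfolding all_corners_def by blast
  qed
  have no_corner: "pt t 1 1 \<notin> all_corners (refine F)"
    using refined_corner_cases[OF W t(1), of "pt t 1 1"] pt_in_tile[of 1 1 t]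
    by (auto simp: marks_pt_iff[OF nd] pt_eq_iff[OF nd])
  show "?c (vp d) \<noteq> ?c (vq d) \<and> ?c (vq d) \<noteq> ?c (vr d) \<and>
    (if vm d \<in> all_corners (refine F) then ?c (vp d) \<noteq> ?c (vm d) \<and> ?c (vm d) \<noteq> ?c (vr d)
     else ?c (vp d) \<noteq> ?c (vr d))"
  proof (cases "\<exists>t'\<in>F. rotated_neighbour t t'")
    case True
    then obtain t' where t': "t' \<in> F" "rotated_neighbour t t'" by blast
    have r': "rotated_neighbour t' t" using t'(2) by (auto simp: rotated_neighbour_def)
    have mid: "pt t 2 1 = pt t' 2 2" "pt t 2 3 = pt t' 2 0"
      using pt_hyp_rotated[of t t' 1] pt_hyp_rotated[of t t' 3] r' by (auto simp: rotated_neighbour_def)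
    have "chE t' \<in> refine F" "chA t' \<in> refine F"
      using t'(1) by (auto simp: refine_def children_def)
    then have mids: "pt t 2 1 \<in> all_corners (refine F)" "pt t 2 3 \<in> all_corners (refine F)"
      unfolding all_corners_def mid by (force simp: corners_def child_points)+
    \<comment> \<open>Both cut points of the rotated tile carry the colour of its right angle. They
      subdivide the long legs of C and E, so (2, 0) and (2, 2) may both have the colour of
      \<open>vp t\<close>.\<close>
    have c_mid: "?c (pt t 2 1) = c (vp t')" "?c (pt t 2 3) = c (vp t')"
      unfolding mid using base[OF t'(1)] r' t(1) by auto
    have "c (vq t') \<noteq> c (vp t')" using P t'(1) by (simp add: preparatory_def)
    then have "c (vr t) \<noteq> c (vp t')" using t'(2) by (simp add: rotated_neighbour_def)
    then show ?thesis
      using t(2) prep(1-3) prep(5)[OF t'] i True mids c_mid corner no_corner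
      by (elim childE) (auto simp: child_points base_t)
  next
    case False
    \<comment> \<open>Now the long legs of C and E are single edges: C needs \<open>h\<close> to
      differ from \<open>c (vp t)\<close>, and E needs \<open>c (vr t) = c (vq t)\<close> to differ
      from it.\<close>
    have "pt t 2 1 \<notin> all_corners (refine F)" "pt t 2 3 \<notin> all_corners (refine F)"
      using refined_corner_cases[OF W t(1), of "pt t 2 1"] refined_corner_cases[OF W t(1), of "pt t 2 3"]
        pt_in_tile[of 2 1 t] pt_in_tile[of 2 3 t] False
      by (auto simp: marks_pt_iff[OF nd] pt_eq_iff[OF nd])
    then show ?thesis
      using t(2) prep(1-3) prep(4) i h False corner no_corner
      by (elim childE) (auto simp: child_points base_t)
  qed
qed

text \<open>The outer triangle stays fixed and the frames shrink by \<open>sqrt 5\<close> in each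
  step, so all points have coordinates with denominators a power of 5.\<close>

primrec level :: "nat \<Rightarrow> frame set" where
  "level 0 = {((0, 0), (1, 0), (0, 1))}"
| "level (Suc n) = refine (level n)"

lemma level_frames:
  assumes "t \<in> level n"
  shows "nondeg t" "grid_frame t" "frame_size t = (1 / 5) ^ n"
proof -
  have "nondeg t \<and> grid_frame t \<and> frame_size t = (1 / 5) ^ n"
    using assms
  proof (induction n arbitrary: t)
    case 0
    have "grid True (0, 0)" "grid False (1, 0)" "grid False (0, 1)"
      unfolding grid_def
      by (rule exI[of _ 0], rule exI[of _ 0], rule exI[of _ 0], simp)
         (rule exI[of _ 0], rule exI[of _ 1], rule exI[of _ 0], simp,
          rule exI[of _ 0], rule exI[of _ 0], rule exI[of _ 1], simp)
    with 0 show ?case by (auto simp: nondeg_def grid_frame_def frame_size_def zero_prod_def)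
  next
    case (Suc n)
    then obtain s where s: "s \<in> level n" "t \<in> children s" by (auto simp: refine_def)
    with Suc.IH[OF s(1)] show ?case
      by (auto simp: nondeg_child grid_frame_child frame_size_child)
  qed
  then show "nondeg t" "grid_frame t" "frame_size t = (1 / 5) ^ n" by auto
qed

lemma well_matched_level: "well_matched (level n)"
proof (induction n)
  case 0
  then show ?case using level_frames(1)[of _ 0] by (auto simp: well_matched_def)
qed (simp add: well_matched_refine)

lemma level_colouring: "\<exists>c. (\<forall>z. c z < 3) \<and> proper_on (level (Suc (Suc n))) c"
proof -
  have P: "preparatory (level (Suc n)) (parity_colour (level n))"
    using preparatory_parity_colour[OF well_matched_level] level_frames(2) by auto
  show ?thesis
    using proper_on_refined_colour[OF well_matched_level P] refined_colour_less[OF P] by auto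
qed

section \<open>The patches as iterated substitutions\<close>

text \<open>A common frame for the coordinate maps of tiles and for isometries composed with
  scaling.\<close>

definition affine_bij :: "(plane \<Rightarrow> plane) \<Rightarrow> bool" where
  "affine_bij A \<longleftrightarrow> (\<exists>b L. linear L \<and> inj L \<and> A = (\<lambda>z. b + L z))"

lemma affine_bij_bij:
  assumes "affine_bij A"
  shows "bij A"
proof -
  obtain b L where L: "linear L" "inj L" "A = (\<lambda>z. b + L z)" using assms by (auto simp: affine_bij_def)
  have "surj L" using linear_injective_imp_surjective L by blast
  then have "bij ((+) b \<circ> L)" using L by (intro bij_comp) (auto simp: bij_def)
  then show ?thesis by (simp add: L(3) comp_def)
qed

lemma affine_bij_interior:
  assumes "affine_bij A"
  shows "interior (A ` S) = A ` interior S"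
proof -
  obtain b L where L: "linear L" "inj L" "A = (\<lambda>z. b + L z)" using assms by (auto simp: affine_bij_def)
  have eq: "A ` S = (+) b ` L ` S" for S by (auto simp: L(3))
  show ?thesis unfolding eq interior_translation interior_injective_linear_image[OF L(1,2)] ..
qed

lemma affine_bij_closed:
  assumes "affine_bij A" "closed S"
  shows "closed (A ` S)"
proof -
  obtain b L where L: "linear L" "inj L" "A = (\<lambda>z. b + L z)" using assms by (auto simp: affine_bij_def)
  have eq: "A ` S = (+) b ` L ` S" for S by (auto simp: L(3))
  show ?thesis unfolding eq using closed_injective_linear_image[OF assms(2) L(1,2)] by (rule closed_translation)
qed

lemma affine_bij_segment:
  assumes "affine_bij A"
  shows "closed_segment (A x) (A y) = A ` closed_segment x y"
    and "open_segment (A x) (A y) = A ` open_segment x y"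
proof -
  obtain b L where L: "linear L" "inj L" "A = (\<lambda>z. b + L z)" using assms by (auto simp: affine_bij_def)
  have eq: "A ` S = (+) b ` L ` S" for S by (auto simp: L(3))
  show "closed_segment (A x) (A y) = A ` closed_segment x y"
    unfolding eq closed_segment_linear_image[OF L(1), symmetric] by (simp add: L(3) closed_segment_translation)
  show "open_segment (A x) (A y) = A ` open_segment x y"
    unfolding eq open_segment_linear_image[OF L(1,2), symmetric] by (simp add: L(3) open_segment_translation)
qed

lemma affine_bij_extreme_point:
  assumes "affine_bij A"
  shows "A x extreme_point_of A ` S \<longleftrightarrow> x extreme_point_of S"
  using bij_is_inj[OF affine_bij_bij[OF assms]]
  by (simp add: extreme_point_of_def affine_bij_segment[OF assms] inj_image_mem_iff)

lemma isometry_affine: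
  assumes "isometry_plane g"
  obtains L where "orthogonal_transformation L" "g = (\<lambda>z. g 0 + L z)"
proof
  show "orthogonal_transformation (\<lambda>z. g z - g 0)"
    unfolding orthogonal_transformation_isometry using assms by (simp add: isometry_plane_def dist_norm)
qed auto

lemma affine_bij_isometry_scale:
  assumes "isometry_plane g" "r \<noteq> 0"
  shows "affine_bij (\<lambda>z. g (r *\<^sub>R z))"
proof -
  obtain L where L: "orthogonal_transformation L" "g = (\<lambda>z. g 0 + L z)" using isometry_affine[OF assms(1)] .
  have "linear L" using L(1) by (rule orthogonal_transformation_linear)
  then have "linear (\<lambda>z. L (r *\<^sub>R z))"
    using linear_compose[OF linear_scale_self[of r] \<open>linear L\<close>] by (simp add: comp_def)
  moreover have "inj (\<lambda>z. L (r *\<^sub>R z))"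
    using orthogonal_transformation_inj[OF L(1)] assms(2) by (intro injI) (metis injD scaleR_cancel_left)
  ultimately show ?thesis unfolding affine_bij_def using L(2) by metis
qed

lemma affine_bij_isometry: "isometry_plane g \<Longrightarrow> affine_bij g"
  using affine_bij_isometry_scale[of g 1] by simp

text \<open>The expanded prototile in its prescribed position, for which \<open>pt\<close> is the
  identity.\<close>

definition root_frame :: frame where "root_frame = ((0, 0), (2, - 1), (1, 2))"

lemma pt_root_frame: "pt root_frame x y = (x, y)"
  by (simp add: pt_def root_frame_def field_simps)

lemma nondeg_root_frame: "nondeg root_frame"
  by (simp add: nondeg_def root_frame_def zero_prod_def)

lemma pt_affine:
  assumes "nondeg t"
  shows "affine_bij (\<lambda>z. pt t (fst z) (snd z))"
proof -
  obtain p u v where t: "t = (p, u, v)" by (cases t)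
  let ?L = "\<lambda>z. ((2 * fst z - snd z) / 5) *\<^sub>R u + ((fst z + 2 * snd z) / 5) *\<^sub>R v"
  have "linear ?L" by (intro linearI) (simp_all add: prod_eq_iff field_simps)
  moreover have "inj ?L"
  proof (rule injI)
    fix z w assume "?L z = ?L w"
    then have "pt t (fst z) (snd z) = pt t (fst w) (snd w)" by (simp add: t pt_def add.assoc)
    then show "z = w" unfolding pt_eq_iff[OF assms] by (simp add: prod_eq_iff)
  qed
  moreover have "(\<lambda>z. pt t (fst z) (snd z)) = (\<lambda>z. p + ?L z)" by (simp add: t pt_def add.assoc)
  ultimately show ?thesis unfolding affine_bij_def by blast
qed

lemma tile_of_root: "tile_of t = (\<lambda>z. pt t (fst z) (snd z)) ` tile_of root_frame"
  and inner_tile_root: "inner_tile t = (\<lambda>z. pt t (fst z) (snd z)) ` inner_tile root_frame"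
  and corners_root: "corners t = (\<lambda>z. pt t (fst z) (snd z)) ` corners root_frame"
  by (force simp: tile_of_def inner_tile_def corners_def vp_def vq_def vr_def pt_root_frame)+

lemma tile_of_hull: "tile_of t = convex hull {vp t, vq t, vr t}"
proof -
  obtain p u v where t: "t = (p, u, v)" by (cases t)
  \<comment> \<open>Barycentric coordinates: each coefficient vanishes on the side opposite to its
    corner.\<close>
  have eq: "pt t x y = (1 - x / 2) *\<^sub>R vp t + ((2 * x - y) / 5) *\<^sub>R vq t + ((x + 2 * y) / 10) *\<^sub>R vr t" for x y
    unfolding t vp_def vq_def vr_def pt_def by (simp add: prod_eq_iff field_simps)
  show ?thesis
  proof (intro set_eqI iffI)
    fix z assume "z \<in> tile_of t"
    then obtain x y where "z = pt t x y" "x \<le> 2" "0 \<le> x + 2 * y" "y \<le> 2 * x" by (auto simp: tile_of_def)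
    then show "z \<in> convex hull {vp t, vq t, vr t}"
      unfolding convex_hull_3 eq
      by (intro CollectI exI[of _ "1 - x / 2"] exI[of _ "(2 * x - y) / 5"] exI[of _ "(x + 2 * y) / 10"])
         (auto simp: field_simps)
  next
    fix z assume "z \<in> convex hull {vp t, vq t, vr t}"
    then obtain a b c where abc: "0 \<le> a" "0 \<le> b" "0 \<le> c" "a + b + c = 1"
      "z = a *\<^sub>R vp t + b *\<^sub>R vq t + c *\<^sub>R vr t" by (auto simp: convex_hull_3)
    have "z = pt t (2 * b + 2 * c) (4 * c - b)"
    proof -
      have "1 - (2 * b + 2 * c) / 2 = a" "(2 * (2 * b + 2 * c) - (4 * c - b)) / 5 = b"
        "(2 * b + 2 * c + 2 * (4 * c - b)) / 10 = c" using abc(4) by (auto simp: field_simps)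
      then show ?thesis unfolding eq abc(5) by simp
    qed
    then show "z \<in> tile_of t" using abc(1-4) by (auto intro!: pt_in_tile)
  qed
qed

lemma inner_tile_root_frame: "interior (tile_of root_frame) = inner_tile root_frame"
proof -
  have "tile_of root_frame = {z. (1, 0) \<bullet> z \<le> 2} \<inter> ({z. (- 1, - 2) \<bullet> z \<le> 0} \<inter> {z. (- 2, 1) \<bullet> z \<le> 0})"
    by (auto simp: tile_of_def pt_root_frame)
  then have "interior (tile_of root_frame) =
      {z. (1, 0) \<bullet> z < 2} \<inter> ({z. (- 1, - 2) \<bullet> z < 0} \<inter> {z. (- 2, 1) \<bullet> z < 0})"
    by (simp add: interior_Int interior_halfspace_le zero_prod_def)
  also have "\<dots> = inner_tile root_frame"
    by (auto simp: inner_tile_def pt_root_frame)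
  finally show ?thesis .
qed

lemma extreme_root_frame: "x extreme_point_of tile_of root_frame \<longleftrightarrow> x \<in> corners root_frame"
proof -
  have "\<not> collinear {0, (2, - 1), (2, 4) :: plane}"
    unfolding collinear_lemma by (simp add: zero_prod_def)
  then have "\<not> affine_dependent {vp root_frame, vq root_frame, vr root_frame}"
    unfolding collinear_3_eq_affine_dependent
    by (simp add: vp_def vq_def vr_def pt_root_frame zero_prod_def)
  then show ?thesis
    unfolding tile_of_hull corners_def by (rule extreme_point_of_convex_hull_affine_independent)
qed

lemma affine_bij_comp:
  assumes "affine_bij A" "affine_bij B"
  shows "affine_bij (\<lambda>z. A (B z))"
proof -
  obtain b L where L: "linear L" "inj L" "A = (\<lambda>z. b + L z)" using assms by (auto simp: affine_bij_def)
  obtain b' L' where L': "linear L'" "inj L'" "B = (\<lambda>z. b' + L' z)" using assms by (auto simp: affine_bij_def)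
  have "(\<lambda>z. A (B z)) = (\<lambda>z. (b + L b') + (L \<circ> L') z)"
    by (simp add: L(3) L'(3) linear_add[OF L(1)] add.assoc)
  then show ?thesis unfolding affine_bij_def
    using linear_compose[OF L'(1) L(1)] inj_compose[OF L(2) L'(2)] by blast
qed

lemma extreme_point_tile:
  assumes A: "affine_bij A" and t: "nondeg t"
  shows "x extreme_point_of A ` tile_of t \<longleftrightarrow> x \<in> A ` corners t"
proof -
  define B where "B = (\<lambda>z. A (pt t (fst z) (snd z)))"
  have B: "affine_bij B" unfolding B_def by (intro affine_bij_comp[OF A] pt_affine t)
  obtain y where x: "x = B y" using affine_bij_bij[OF B] by (metis bij_pointE)
  have "A ` tile_of t = B ` tile_of root_frame" "A ` corners t = B ` corners root_frame"
    by (simp_all add: tile_of_root[of t] corners_root[of t] B_def image_image)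
  then show ?thesis
    using affine_bij_extreme_point[OF B] extreme_root_frame affine_bij_bij[OF B]
    by (simp add: x bij_is_inj inj_image_mem_iff)
qed

lemma interior_tile:
  assumes A: "affine_bij A" and t: "nondeg t"
  shows "interior (A ` tile_of t) = A ` inner_tile t"
proof -
  define B where "B = (\<lambda>z. A (pt t (fst z) (snd z)))"
  have B: "affine_bij B" unfolding B_def by (intro affine_bij_comp[OF A] pt_affine t)
  have "A ` tile_of t = B ` tile_of root_frame" "A ` inner_tile t = B ` inner_tile root_frame"
    by (simp_all add: tile_of_root[of t] inner_tile_root[of t] B_def image_image)
  then show ?thesis using affine_bij_interior[OF B] inner_tile_root_frame by simp
qed

lemma frontier_tile:
  assumes A: "affine_bij A" and t: "nondeg t"
  shows "frontier (A ` tile_of t) = A ` (tile_of t - inner_tile t)"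
proof -
  have "closed (tile_of t)" unfolding tile_of_hull
    by (intro compact_imp_closed compact_convex_hull finite_imp_compact) simp
  then have "closed (A ` tile_of t)" by (rule affine_bij_closed[OF A])
  then show ?thesis
    using affine_bij_bij[OF A]
    by (simp add: frontier_def interior_tile[OF A t] image_set_diff bij_is_inj)
qed

section \<open>Rigidity of tiles and identification of the patches with the substitution\<close>

lemma dist_pt:
  assumes "nondeg t"
  shows "(dist (pt t x y) (pt t x' y'))\<^sup>2 = ((x - x')\<^sup>2 + (y - y')\<^sup>2) / 5 * frame_size t"
  unfolding dist_norm power2_norm_eq_inner inner_pt_diff[OF assms] by (simp add: power2_eq_square)

text \<open>Differences of the squared distances are linear in the point, and the three corners are
  not collinear.\<close>

lemma point_eq_if_dist_corners_eq:
  fixes z w :: plane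
  assumes "dist z (0, 0) = dist w (0, 0)" "dist z (2, - 1) = dist w (2, - 1)" "dist z (2, 4) = dist w (2, 4)"
  shows "z = w"
proof -
  obtain x y x' y' where zw: "z = (x, y)" "w = (x', y')" by (cases z, cases w)
  have "x\<^sup>2 + y\<^sup>2 = x'\<^sup>2 + y'\<^sup>2" "(x - 2)\<^sup>2 + (y + 1)\<^sup>2 = (x' - 2)\<^sup>2 + (y' + 1)\<^sup>2"
    "(x - 2)\<^sup>2 + (y - 4)\<^sup>2 = (x' - 2)\<^sup>2 + (y' - 4)\<^sup>2"
    using assms by (simp_all add: zw dist_Pair_Pair dist_real_def)
  then have "- 4 * x + 2 * y = - 4 * x' + 2 * y'" "- 4 * x - 8 * y = - 4 * x' - 8 * y'"
    by (simp_all add: power2_eq_square algebra_simps)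
  then show ?thesis by (simp add: zw)
qed

text \<open>Both maps send corners to corners, since these are the extreme points. The distances
  \<open>sqrt 5\<close>, \<open>sqrt 20\<close> and 5 are distinct, so no permutation of the corners
  is possible.\<close>

lemma isometry_eq:
  assumes g: "isometry_plane g" and h: "isometry_plane h"
    and eq: "g ` tile_of root_frame = h ` tile_of root_frame"
  shows "g = h"
proof
  fix z
  let ?p = "(0, 0) :: plane" and ?q = "(2, - 1) :: plane" and ?r = "(2, 4) :: plane"
  have root: "corners root_frame = {?p, ?q, ?r}" by (simp add: corners_def vp_def vq_def vr_def pt_root_frame)
  have "g ` {?p, ?q, ?r} = h ` {?p, ?q, ?r}"
    using extreme_point_tile[OF affine_bij_isometry[OF g] nondeg_root_frame]
      extreme_point_tile[OF affine_bij_isometry[OF h] nondeg_root_frame]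
    unfolding eq root by blast
  then obtain a b c where abc: "g ?p = h a" "g ?q = h b" "g ?r = h c"
    "a \<in> {?p, ?q, ?r}" "b \<in> {?p, ?q, ?r}" "c \<in> {?p, ?q, ?r}" by blast
  have dg: "dist (g x) (g y) = dist x y" and dh: "dist (h x) (h y) = dist x y" for x y
    using g h unfolding isometry_plane_def by blast+
  have "dist a b = dist ?p ?q" "dist a c = dist ?p ?r" "dist b c = dist ?q ?r"
    by (metis dg dh abc)+
  moreover have "sqrt 25 = 5" by (rule real_sqrt_unique) simp_all
  moreover have "sqrt 5 \<noteq> sqrt 25" "sqrt 20 \<noteq> sqrt 25" unfolding real_sqrt_eq_iff by simp_all
  ultimately have "a = ?p \<and> b = ?q \<and> c = ?r"
    using abc(4-6) by (auto simp: dist_Pair_Pair dist_real_def)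
  then have gh: "g ?p = h ?p" "g ?q = h ?q" "g ?r = h ?r" using abc by auto
  obtain w where w: "g z = h w" using affine_bij_bij[OF affine_bij_isometry[OF h]] by (metis bij_pointE)
  have "w = z"
    by (rule point_eq_if_dist_corners_eq) (metis dg dh gh w)+
  then show "g z = h z" using w by simp
qed

lemma dissection_root: "dissection = tile_of ` children root_frame"
  unfolding dissection_def children_def
  by (simp add: tile_of_hull child_points pt_root_frame insert_commute)

lemma expanded_root: "expanded_prototile = tile_of root_frame"
  unfolding expanded_prototile_def tile_of_hull by (simp add: vp_def vq_def vr_def pt_root_frame)

lemma children_root:
  "tile_of ` children t = (\<lambda>S. (\<lambda>z. pt t (fst z) (snd z)) ` S) ` tile_of ` children root_frame"
proof -
  have "tile_of (chA t) = (\<lambda>z. pt t (fst z) (snd z)) ` tile_of (chA root_frame)"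
    "tile_of (chB t) = (\<lambda>z. pt t (fst z) (snd z)) ` tile_of (chB root_frame)"
    "tile_of (chC t) = (\<lambda>z. pt t (fst z) (snd z)) ` tile_of (chC root_frame)"
    "tile_of (chD t) = (\<lambda>z. pt t (fst z) (snd z)) ` tile_of (chD root_frame)"
    "tile_of (chE t) = (\<lambda>z. pt t (fst z) (snd z)) ` tile_of (chE root_frame)"
    unfolding tile_of_child pt_root_frame by force+
  then show ?thesis by (simp add: children_def)
qed

lemma substitution_tile_frame:
  assumes t: "nondeg t" "frame_size t = (1 / 5) ^ n"
  shows "substitution_tile ((\<lambda>z. sqrt 5 ^ n *\<^sub>R z) ` tile_of t) =
    (\<lambda>d. (\<lambda>z. sqrt 5 ^ Suc n *\<^sub>R z) ` tile_of d) ` children t"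
proof -
  \<comment> \<open>The coordinates of \<open>t\<close> shrink squared distances by
    \<open>frame_size t / 5\<close>, that is (1/5)^(n+1), which this scaling cancels. So
    \<open>h\<close> is the one isometry in the definition of
    \<open>substitution_tile\<close>.\<close>
  define h where "h = (\<lambda>z. sqrt 5 ^ Suc n *\<^sub>R pt t (fst z) (snd z))"
  have h: "isometry_plane h"
    unfolding isometry_plane_def
  proof (intro allI)
    fix z w :: plane
    have "(dist (h z) (h w))\<^sup>2 = (sqrt 5 ^ Suc n)\<^sup>2 * (dist (pt t (fst z) (snd z)) (pt t (fst w) (snd w)))\<^sup>2"
      unfolding h_def dist_norm scaleR_diff_right[symmetric] norm_scaleR by (simp add: power_mult_distrib)
    also have "(sqrt 5 ^ Suc n)\<^sup>2 = (5::real) ^ Suc n"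
      by (metis power_mult mult.commute real_sqrt_pow2 zero_le_numeral)
    finally have "(dist (h z) (h w))\<^sup>2 = (fst z - fst w)\<^sup>2 + (snd z - snd w)\<^sup>2"
      unfolding dist_pt[OF t(1)] t(2) by (simp add: power_one_over)
    also have "\<dots> = (dist z w)\<^sup>2"
      by (simp add: dist_prod_def dist_real_def)
    finally show "dist (h z) (h w) = dist z w" by (simp add: power2_eq_iff_nonneg)
  qed
  have ht: "h ` tile_of root_frame = (\<lambda>x. sqrt 5 *\<^sub>R x) ` (\<lambda>z. sqrt 5 ^ n *\<^sub>R z) ` tile_of t"
    unfolding tile_of_root[of t] h_def image_image by simp
  have "substitution_tile ((\<lambda>z. sqrt 5 ^ n *\<^sub>R z) ` tile_of t) = {h ` d | d. d \<in> dissection}"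
    unfolding substitution_tile_def expanded_root ht[symmetric] using h isometry_eq[OF _ h] by blast
  also have "\<dots> = (\<lambda>S. (\<lambda>z. sqrt 5 ^ Suc n *\<^sub>R z) ` S) ` tile_of ` children t"
    unfolding dissection_root children_root[of t] h_def image_image by blast
  finally show ?thesis by (simp add: image_image)
qed

lemma substitution_level:
  "(substitution ^^ n) {prototile} = (\<lambda>t. (\<lambda>z. sqrt 5 ^ n *\<^sub>R z) ` tile_of t) ` level n"
proof (induction n)
  case 0
  have "prototile = tile_of ((0, 0), (1, 0), (0, 1))"
    unfolding prototile_def tile_of_hull by (simp add: vp_def vq_def vr_def pt_def)
  then show ?case by simp
next
  case (Suc n)
  have "(substitution ^^ Suc n) {prototile} = (\<Union>t\<in>level n. substitution_tile ((\<lambda>z. sqrt 5 ^ n *\<^sub>R z) ` tile_of t))"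
    by (simp add: Suc.IH substitution_def)
  also have "\<dots> = (\<Union>t\<in>level n. (\<lambda>d. (\<lambda>z. sqrt 5 ^ Suc n *\<^sub>R z) ` tile_of d) ` children t)"
    using substitution_tile_frame level_frames by (intro SUP_cong refl) blast
  finally show ?case by (simp add: refine_def image_UN)
qed

section \<open>From patches to tilings\<close>

definition copy_level :: "(plane \<Rightarrow> plane) \<Rightarrow> nat \<Rightarrow> tile set" where
  "copy_level H n = (\<lambda>t. H ` tile_of t) ` level n"

text \<open>An edge in the boundary of \<open>t\<close> joins two of its four marks. The pair q, m
  is a chord through the interior, shown by its midpoint (3/2, 1/2), and the pair p, r occurs only
  if m is no corner; \<open>proper_on\<close> handles the others.\<close>

lemma segment_marks_colour:
  assumes W: "well_matched F" and P: "proper_on F c" and t: "t \<in> F"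
    and ab: "a \<in> all_corners F" "b \<in> all_corners F" "a \<noteq> b"
    and cl: "closed_segment a b \<subseteq> tile_of t - inner_tile t"
    and op: "open_segment a b \<inter> all_corners F = {}"
  shows "c a \<noteq> c b"
proof -
  note nd = well_matchedD(1)[OF W t]
  have *: "x \<in> marks t" if "x \<in> all_corners F" "x \<in> tile_of t" for x
    using that corners_subset_marks well_matchedD(3)[OF W t] unfolding all_corners_def by blast
  then have marks: "a \<in> marks t" "b \<in> marks t"
    using *[OF ab(1)] *[OF ab(2)] cl ends_in_segment[of a b] by blast+
  obtain p u v where puv: "t = (p, u, v)" by (cases t)
  have eq: "vm t = (1 / 2) *\<^sub>R vp t + (1 / 2) *\<^sub>R vr t"
    unfolding vp_def vr_def vm_def puv pt_def by (simp add: prod_eq_iff field_simps)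
  have eq': "pt t (3 / 2) (1 / 2) = (1 / 2) *\<^sub>R vq t + (1 / 2) *\<^sub>R vm t"
    unfolding vq_def vm_def puv pt_def by (simp add: prod_eq_iff field_simps)
  have neq: "vp t \<noteq> vr t" by (simp add: vp_def vr_def pt_eq_iff[OF nd])
  have "vm t \<in> open_segment (vp t) (vr t)" 
    unfolding in_segment eq using neq by (auto intro!: exI[of _ "1 / 2"])
  then have 1: "vm t \<notin> all_corners F" if "{a, b} = {vp t, vr t}"
    using op that by (auto simp: doubleton_eq_iff open_segment_commute)
  have "pt t (3 / 2) (1 / 2) \<in> closed_segment (vq t) (vm t)"
    unfolding in_segment eq' by (auto intro!: exI[of _ "1 / 2"])
  moreover have "pt t (3 / 2) (1 / 2) \<in> inner_tile t" by (rule pt_in_inner) auto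
  ultimately have 2: "{a, b} \<noteq> {vq t, vm t}"
    using cl by (auto simp: doubleton_eq_iff closed_segment_commute)
  have "c (vp t) \<noteq> c (vq t)" "c (vq t) \<noteq> c (vr t)"
    "vm t \<in> all_corners F \<Longrightarrow> c (vp t) \<noteq> c (vm t)" "vm t \<in> all_corners F \<Longrightarrow> c (vm t) \<noteq> c (vr t)"
    "vm t \<notin> all_corners F \<Longrightarrow> c (vp t) \<noteq> c (vr t)"
    using P t unfolding proper_on_def by presburger+
  then show ?thesis using marks 1 2 ab unfolding marks_def
    by (elim insertE emptyE; hypsubst; simp add: doubleton_eq_iff)
qed

lemma copy_level_vertices:
  assumes "affine_bij H"
  shows "tiling_vertices (copy_level H n) = H ` all_corners (level n)"
  unfolding tiling_vertices_def copy_level_def all_corners_def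
  using extreme_point_tile[OF assms level_frames(1)] by auto

lemma copy_level_edge_colour:
  assumes H: "affine_bij H" and c: "proper_on (level n) c" and e: "{u, v} \<in> tiling_edges (copy_level H n)"
  shows "c (inv H u) \<noteq> c (inv H v)"
proof -
  have injH: "inj H" using affine_bij_bij[OF H] by (rule bij_is_inj)
  \<comment> \<open>Edges are unordered, so the pair witnessing membership may be swapped; all
    conditions are symmetric.\<close>
  have symm: "\<exists>s\<in>copy_level H n. u \<in> tiling_vertices (copy_level H n) \<and> v \<in> tiling_vertices (copy_level H n) \<and> u \<noteq> v \<and>
      closed_segment u v \<subseteq> frontier s \<and> open_segment u v \<inter> tiling_vertices (copy_level H n) = {}"
    using e unfolding tiling_edges_def
    by (auto simp: doubleton_eq_iff closed_segment_commute open_segment_commute)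
  then obtain a b t where ab: "a \<in> all_corners (level n)" "b \<in> all_corners (level n)" "u = H a" "v = H b"
    and t: "t \<in> level n" "closed_segment u v \<subseteq> frontier (H ` tile_of t)"
    and ne: "u \<noteq> v" and op: "open_segment u v \<inter> H ` all_corners (level n) = {}"
    unfolding copy_level_vertices[OF H] by (auto simp: copy_level_def)
  have "closed_segment a b \<subseteq> tile_of t - inner_tile t"
    using t(2) unfolding ab frontier_tile[OF H level_frames(1)[OF t(1)]] affine_bij_segment(1)[OF H]
    by (simp add: inj_image_subset_iff[OF injH])
  moreover have "open_segment a b \<inter> all_corners (level n) = {}"
    using op unfolding ab affine_bij_segment(2)[OF H] by auto
  ultimately have "c a \<noteq> c b"
    using segment_marks_colour[OF well_matched_level c t(1) ab(1,2)] ne ab by auto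
  then show ?thesis using ab injH by simp
qed

lemma copy_level_overlap:
  assumes H: "affine_bij H" and s: "s \<in> copy_level H n" "s' \<in> copy_level H n" "interior s \<inter> s' \<noteq> {}"
  shows "s = s'"
proof -
  obtain t t' where t: "t \<in> level n" "s = H ` tile_of t" "t' \<in> level n" "s' = H ` tile_of t'"
    using s(1,2) unfolding copy_level_def by blast
  have "inner_tile t \<inter> tile_of t' \<noteq> {}"
    using s(3) unfolding t interior_tile[OF H level_frames(1)[OF t(1)]]
      image_Int[OF bij_is_inj[OF affine_bij_bij[OF H]], symmetric] by simp
  then have "t = t'" using well_matchedD(2)[OF well_matched_level t(3,1)] by blast
  then show ?thesis using t by simp
qed

text \<open>A tile lies in a 2 by 5 box of its coordinates. The squared distance is thus at most
  29/5 < 9 for a unit-scale tile, and at most 29 < 36 for its parent.\<close>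

lemma dist_tile:
  assumes g: "isometry_plane g" and t: "nondeg t" "frame_size t = (1 / 5) ^ m"
    and zw: "z \<in> (\<lambda>z. g (sqrt 5 ^ n *\<^sub>R z)) ` tile_of t" "w \<in> (\<lambda>z. g (sqrt 5 ^ n *\<^sub>R z)) ` tile_of t"
    and n: "n = m \<or> n = Suc m"
  shows "dist z w \<le> 6" "n = m \<Longrightarrow> dist z w \<le> 3"
proof -
  obtain x y x' y' where xy: "x \<le> 2" "0 \<le> x + 2 * y" "y \<le> 2 * x" "x' \<le> 2" "0 \<le> x' + 2 * y'" "y' \<le> 2 * x'"
    "z = g (sqrt 5 ^ n *\<^sub>R pt t x y)" "w = g (sqrt 5 ^ n *\<^sub>R pt t x' y')"
    using zw by (auto simp: tile_of_def)
  have "\<bar>x - x'\<bar> \<le> 2" "\<bar>y - y'\<bar> \<le> 5" using xy(1-6) by linarith+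
  then have b: "(x - x')\<^sup>2 + (y - y')\<^sup>2 \<le> 2\<^sup>2 + 5\<^sup>2" 
    using abs_le_square_iff[of "x - x'" 2] abs_le_square_iff[of "y - y'" 5] by (intro add_mono) simp_all
  have "dist z w = sqrt 5 ^ n * dist (pt t x y) (pt t x' y')"
    unfolding xy using g[unfolded isometry_plane_def, rule_format, of "sqrt 5 ^ n *\<^sub>R pt t x y"]
    by (simp add: dist_norm scaleR_diff_right[symmetric] del: scaleR_diff_right)
  then have "(dist z w)\<^sup>2 = (sqrt 5 ^ n)\<^sup>2 * (((x - x')\<^sup>2 + (y - y')\<^sup>2) / 5 * (1 / 5) ^ m)"
    by (simp add: power_mult_distrib dist_pt[OF t(1)] t(2))
  also have "(sqrt 5 ^ n)\<^sup>2 = (5::real) ^ n"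
    by (metis power_mult mult.commute real_sqrt_pow2 zero_le_numeral)
  finally have *: "(dist z w)\<^sup>2 = ((x - x')\<^sup>2 + (y - y')\<^sup>2) / 5 * (5 ^ n * (1 / 5) ^ m)" by simp
  show "dist z w \<le> 3" if "n = m"
  proof (rule power2_le_imp_le)
    show "(dist z w)\<^sup>2 \<le> 3\<^sup>2" using * b that by (simp add: power_one_over)
  qed simp
  show "dist z w \<le> 6"
  proof (rule power2_le_imp_le)
    show "(dist z w)\<^sup>2 \<le> 6\<^sup>2" using * b n by (auto simp: power_one_over)
  qed simp
qed

section \<open>Packing: tilings are locally finite and infinite\<close>

lemma congruent_tile:
  assumes "congruent prototile s"
  obtains g where "isometry_plane g" "s = g ` tile_of ((0, 0), (1, 0), (0, 1))"
proof -
  have "prototile = tile_of ((0, 0), (1, 0), (0, 1))"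
    unfolding prototile_def tile_of_hull by (simp add: vp_def vq_def vr_def pt_def)
  then show thesis using assms that unfolding congruent_def by auto
qed

lemma congruent_tile_dist:
  assumes "congruent prototile s" "z \<in> s" "w \<in> s"
  shows "dist z w \<le> 3"
proof -
  obtain g where g: "isometry_plane g" "s = g ` tile_of ((0, 0), (1, 0), (0, 1))"
    using congruent_tile[OF assms(1)] .
  let ?K = "((0, 0), (1, 0), (0, 1)) :: frame"
  have "?K \<in> level 0" by simp
  from level_frames[OF this] show ?thesis
    using dist_tile(2)[OF g(1), of ?K 0 z 0 w] assms(2,3) unfolding g(2) by simp
qed

lemma prototile_ball: "\<exists>r>0. \<forall>s. congruent prototile s \<longrightarrow> (\<exists>z. ball z r \<subseteq> s)"
proof -
  let ?K = "((0, 0), (1, 0), (0, 1)) :: frame"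
  have "?K \<in> level 0" by simp
  note nd = level_frames(1)[OF this]
  have "affine_bij (\<lambda>z. z)" unfolding affine_bij_def by (intro exI[of _ 0] exI[of _ "\<lambda>z. z"]) (auto simp: linear_id[unfolded id_def])
  from interior_tile[OF this nd] have "interior (tile_of ?K) \<noteq> {}"
    using pt_in_inner[of 1 0 ?K] by auto
  then obtain x r where r: "0 < r" "ball x r \<subseteq> tile_of ?K"
    by (metis all_not_in_conv mem_interior)
  have "\<exists>z. ball z r \<subseteq> s" if cs: "congruent prototile s" for s
  proof -
    obtain g where g: "isometry_plane g" "s = g ` tile_of ?K" using congruent_tile[OF cs] .
    have "ball (g x) r \<subseteq> g ` ball x r"
    proof
      fix w assume w: "w \<in> ball (g x) r"
      obtain y where "w = g y" using affine_bij_bij[OF affine_bij_isometry[OF g(1)]] by (metis bij_pointE)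
      moreover have "dist (g x) (g y) = dist x y" using g(1) unfolding isometry_plane_def by blast
      ultimately show "w \<in> g ` ball x r" using w by simp
    qed
    then show ?thesis using r g by blast
  qed
  then show ?thesis using r(1) by blast
qed

text \<open>Each tile contains a ball of the same radius \<open>r\<close>. Disjoint interiors keep
  the centres at least \<open>r\<close> apart, so infinitely many of them in a bounded region
  contradict Bolzano-Weierstrass.\<close>

lemma tiling_locally_finite:
  assumes T: "tiling_by prototile T"
  shows "finite {s \<in> T. s \<inter> ball 0 R \<noteq> {}}" (is "finite ?F")
proof (rule ccontr)
  assume inf: "infinite ?F"
  obtain r where r: "0 < r" "\<And>s. s \<in> T \<Longrightarrow> \<exists>z. ball z r \<subseteq> s"
    using prototile_ball T unfolding tiling_by_def by metis
  then obtain z where z: "\<And>s. s \<in> T \<Longrightarrow> ball (z s) r \<subseteq> s" by metis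
  have far: "r \<le> dist (z s) (z s')" if "s \<in> T" "s' \<in> T" "s \<noteq> s'" for s s'
  proof (rule ccontr)
    assume "\<not> ?thesis"
    then have "z s' \<in> ball (z s) r \<inter> ball (z s') r" using r(1) by simp
    moreover have "ball (z s) r \<subseteq> interior s" "ball (z s') r \<subseteq> interior s'"
      using z that by (simp_all add: interior_maximal)
    ultimately show False using T that unfolding tiling_by_def by blast
  qed
  have "inj_on z ?F"
    using far r(1) by (intro inj_onI) (metis (mono_tags, lifting) dist_self mem_Collect_eq not_le)
  then have "infinite (z ` ?F)" using inf finite_imageD by blast
  moreover have "z ` ?F \<subseteq> cball 0 (R + 3)"
  proof
    fix w assume "w \<in> z ` ?F"
    then obtain s y where s: "s \<in> T" "w = z s" "y \<in> s" "y \<in> ball 0 R" by blast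
    have "w \<in> s" using z[OF s(1)] r(1) s(2) by auto
    moreover have "congruent prototile s" using T s(1) by (simp add: tiling_by_def)
    ultimately have "dist w y \<le> 3" using congruent_tile_dist s(3) by blast
    then show "w \<in> cball 0 (R + 3)" using s(4) norm_triangle_ineq2[of w y] by (simp add: dist_norm)
  qed
  moreover note compact_cball[of "0::plane" "R + 3", unfolded compact_eq_Bolzano_Weierstrass, rule_format, of "z ` ?F"]
  ultimately obtain x where x: "x islimpt (z ` ?F)" by blast
  then have "infinite (z ` ?F \<inter> ball x (r / 2))"
    using r(1) unfolding islimpt_eq_infinite_ball by simp
  then obtain a where a: "a \<in> z ` ?F \<inter> ball x (r / 2)" and "infinite (z ` ?F \<inter> ball x (r / 2) - {a})"
    using infinite_imp_nonempty[OF \<open>infinite (z ` ?F \<inter> ball x (r / 2))\<close>] infinite_remove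
    by (metis (no_types, lifting) all_not_in_conv)
  then obtain b where b: "b \<in> z ` ?F \<inter> ball x (r / 2) - {a}"
    using infinite_imp_nonempty by blast
  from a b have ab: "a \<in> z ` ?F \<inter> ball x (r / 2)" "b \<in> z ` ?F \<inter> ball x (r / 2)" "a \<noteq> b" by auto
  then have "dist a b < r" using dist_triangle_half_r[of x a r b] by simp
  moreover have "r \<le> dist a b" using ab far by blast
  ultimately show False by simp
qed

lemma card_level: "finite (level n) \<and> card (level n) \<le> 5 ^ n"
proof (induction n)
  case (Suc n)
  have c: "finite (children t)" "card (children t) \<le> 5" for t
    unfolding children_def by (simp_all add: card_insert_if)
  have "card (level (Suc n)) \<le> (\<Sum>t\<in>level n. card (children t))"
    using Suc by (simp add: refine_def card_UN_le)
  also have "\<dots> \<le> (\<Sum>t\<in>level n. 5)" by (intro sum_mono c)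
  also have "\<dots> \<le> 5 ^ Suc n" using Suc by simp
  finally show ?case using Suc c by (simp add: refine_def)
qed simp

lemma tiling_infinite:
  assumes T: "tiling_by prototile T"
  shows "infinite T"
proof
  assume fin: "finite T"
  have "bounded s" if "s \<in> T" for s
  proof -
    have "congruent prototile s" using T that by (auto simp: tiling_by_def)
    then have "\<forall>x\<in>s. \<forall>y\<in>s. dist x y \<le> 3" using congruent_tile_dist by blast
    then show ?thesis by (meson bounded_two_points)
  qed
  then have "bounded (\<Union>T)" using fin by (intro bounded_Union ballI)
  then show False using T unfolding tiling_by_def by (metis not_bounded_UNIV)
qed

lemma pinwheel_tiling_agrees_with_level:
  assumes T: "rational_pinwheel_tiling T"
  obtains k g H where "isometry_plane g" "H = (\<lambda>z. g (sqrt 5 ^ Suc (Suc k) *\<^sub>R z))" "affine_bij H"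
    "\<And>s. s \<inter> ball 0 R \<noteq> {} \<Longrightarrow> s \<in> T \<longleftrightarrow> s \<in> copy_level H (Suc (Suc k))"
proof -
  have tT: "tiling_by prototile T" and
    patch: "\<And>F. finite F \<Longrightarrow> F \<subseteq> T \<Longrightarrow> \<exists>n Q. congruent_patch ((substitution ^^ n) {prototile}) Q \<and> F \<subseteq> Q"
    using T unfolding rational_pinwheel_tiling_def by blast+
  \<comment> \<open>A patch of order n has at most 5^n tiles, so six tiles force n to be at least 2,
    as the colouring of patches requires.\<close>
  obtain F6 where F6: "finite F6" "card F6 = 6" "F6 \<subseteq> T"
    using infinite_arbitrarily_large[OF tiling_infinite[OF tT]] by blast
  \<comment> \<open>The margin 3 bounds the diameter of a tile. A patch tile meeting the smaller
    ball has an inner point in the larger one; the tile of \<open>T\<close> covering that point is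
    in the patch and overlaps it, hence equals it.\<close>
  let ?F = "{s \<in> T. s \<inter> ball 0 (R + 3) \<noteq> {}} \<union> F6"
  have "finite ?F" using tiling_locally_finite[OF tT, of "R + 3"] F6(1) by (rule finite_UnI)
  moreover have "?F \<subseteq> T" using F6(3) by blast
  ultimately obtain n Q where Q: "congruent_patch ((substitution ^^ n) {prototile}) Q" "?F \<subseteq> Q"
    using patch[of ?F] by auto
  then obtain g where g: "isometry_plane g" "Q = (`) g ` (substitution ^^ n) {prototile}"
    by (auto simp: congruent_patch_def)
  define H where "H = (\<lambda>z. g (sqrt 5 ^ n *\<^sub>R z))"
  have H: "affine_bij H" unfolding H_def by (rule affine_bij_isometry_scale[OF g(1)]) simp
  have QH: "Q = copy_level H n"
    unfolding g(2) substitution_level copy_level_def H_def image_image ..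
  have finQ: "finite Q" "card Q \<le> 5 ^ n"
    unfolding QH copy_level_def 
    using card_level[of n] card_image_le[of "level n" "\<lambda>t. H ` tile_of t"] by simp_all
  have "6 \<le> card Q" using F6 Q(2) finQ(1) card_mono[of Q F6] by simp
  then have "6 \<le> (5::nat) ^ n" using finQ(2) by simp
  moreover have "(5::nat) ^ n \<le> 5 ^ 1" if "n < 2" using that by (intro power_increasing) auto
  ultimately have "2 \<le> n" by fastforce
  then obtain k where n: "n = Suc (Suc k)" using le_Suc_ex[of 2 n] by auto
  have sub: "s \<in> Q" if "s \<in> T" "s \<inter> ball 0 (R + 3) \<noteq> {}" for s using that Q(2) by blast
  have "s \<in> T" if s: "s \<in> Q" "s \<inter> ball 0 R \<noteq> {}" for s
  proof -
    obtain t where t: "t \<in> level n" "s = H ` tile_of t" using s(1) by (auto simp: QH copy_level_def)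
    obtain y where y: "y \<in> s" "y \<in> ball 0 R" using s(2) by blast
    have int: "interior s = H ` inner_tile t" unfolding t(2) by (rule interior_tile[OF H level_frames(1)[OF t(1)]])
    then have "H (pt t 1 0) \<in> interior s" by (auto intro!: pt_in_inner)
    then obtain z where z: "z \<in> interior s" by blast
    then have "z \<in> s" using interior_subset by blast
    then have "dist z y \<le> 3"
      using dist_tile(2)[OF g(1) level_frames(1,3)[OF t(1)], of z n y] y unfolding t(2) H_def by blast
    then have zb: "z \<in> ball 0 (R + 3)" using y(2) norm_triangle_ineq2[of z y] by (simp add: dist_norm)
    obtain s' where s': "s' \<in> T" "z \<in> s'" using tT unfolding tiling_by_def by blast
    then have "s' \<in> Q" using sub zb by blast
    then have "s = s'" using copy_level_overlap[OF H, of s n s'] s(1) s'(2) z unfolding QH by blast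
    then show ?thesis using s' by simp
  qed
  moreover have "s \<in> Q" if "s \<in> T" "s \<inter> ball 0 R \<noteq> {}" for s
    using sub[OF that(1)] that(2) subset_ball[of R "R + 3" "0::plane"] by auto
  ultimately show thesis using that[of g H k] g(1) H H_def QH n by blast
qed

section \<open>Transfer of vertices, edges and colourings between patches and the tiling\<close>

lemma vertices_agree:
  assumes "\<And>s. s \<inter> ball 0 R \<noteq> {} \<Longrightarrow> s \<in> T \<longleftrightarrow> s \<in> Q" "x \<in> ball 0 R"
  shows "x \<in> tiling_vertices T \<longleftrightarrow> x \<in> tiling_vertices Q"
proof -
  have "s \<in> T \<longleftrightarrow> s \<in> Q" if "x extreme_point_of s" for s
    using assms(1)[of s] assms(2) that unfolding extreme_point_of_def by blast
  then show ?thesis unfolding tiling_vertices_def by blast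
qed

lemma edges_agree:
  assumes TQ: "\<And>s. s \<inter> ball 0 R \<noteq> {} \<Longrightarrow> s \<in> T \<longleftrightarrow> s \<in> Q"
    and uv: "u \<in> ball 0 R" "v \<in> ball 0 R" and e: "{u, v} \<in> tiling_edges T"
  shows "{u, v} \<in> tiling_edges Q"
proof -
  have "u \<in> tiling_vertices T \<and> v \<in> tiling_vertices T \<and> u \<noteq> v \<and>
      (\<exists>s\<in>T. closed_segment u v \<subseteq> frontier s) \<and> open_segment u v \<inter> tiling_vertices T = {}"
    using e unfolding tiling_edges_def
    by (auto simp: doubleton_eq_iff closed_segment_commute open_segment_commute)
  then obtain s where s: "u \<in> tiling_vertices T" "v \<in> tiling_vertices T" "u \<noteq> v"
    "s \<in> T" "closed_segment u v \<subseteq> frontier s" "open_segment u v \<inter> tiling_vertices T = {}" by blast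
  have "u \<in> closure s" using s(5) ends_in_segment(1)[of u v] by (auto simp: frontier_def)
  then have "ball 0 R \<inter> s \<noteq> {}" using uv(1) open_Int_closure_eq_empty[of "ball 0 R" s] by auto
  then have "s \<in> Q" using TQ[of s] s(4) by (simp add: Int_commute)
  moreover have "open_segment u v \<subseteq> ball 0 R"
    using uv closed_segment_subset[OF uv convex_ball] segment_open_subset_closed by blast
  then have "open_segment u v \<inter> tiling_vertices Q = {}"
    using s(6) vertices_agree[OF TQ] by blast
  moreover have "u \<in> tiling_vertices Q" "v \<in> tiling_vertices Q"
    using s(1,2) vertices_agree[OF TQ] uv by blast+
  ultimately show ?thesis using s(3,5) unfolding tiling_edges_def by blast
qed

lemma pinwheel_colouring_on_ball:
  assumes T: "rational_pinwheel_tiling T"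
  shows "\<exists>c. (\<forall>z. c z < 3) \<and>
    (\<forall>u\<in>ball 0 R. \<forall>v\<in>ball 0 R. {u, v} \<in> tiling_edges T \<longrightarrow> c u \<noteq> (c v :: nat))"
proof -
  obtain k g H where H: "affine_bij H"
    and TQ: "\<And>s. s \<inter> ball 0 R \<noteq> {} \<Longrightarrow> s \<in> T \<longleftrightarrow> s \<in> copy_level H (Suc (Suc k))"
    using pinwheel_tiling_agrees_with_level[OF T, of R] by metis
  obtain c where c: "\<forall>z. c z < 3" "proper_on (level (Suc (Suc k))) c" using level_colouring by blast
  have "c (inv H u) \<noteq> c (inv H v)" if "u \<in> ball 0 R" "v \<in> ball 0 R" "{u, v} \<in> tiling_edges T" for u v
    using copy_level_edge_colour[OF H c(2) edges_agree[OF TQ that]] .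
  then show ?thesis using c(1) by (intro exI[of _ "\<lambda>z. c (inv H z)"]) blast
qed

lemma colouring_by_compactness:
  fixes E :: "plane set set"
  assumes "\<And>R. \<exists>c. (\<forall>z. c z < n) \<and> (\<forall>u\<in>ball 0 R. \<forall>v\<in>ball 0 R. {u, v} \<in> E \<longrightarrow> c u \<noteq> (c v :: nat))"
  shows "\<exists>c. (\<forall>z. c z < n) \<and> (\<forall>u v. {u, v} \<in> E \<longrightarrow> c u \<noteq> c v)"
proof -
  define X where "X = product_topology (\<lambda>_ :: plane. discrete_topology {..<n}) UNIV"
  \<comment> \<open>Each condition involves two discrete coordinates, so these sets are closed in
    the compact product; they decrease with \<open>k\<close>, and every edge is tested from some
    \<open>k\<close> on.\<close>
  define C where "C k = {c \<in> topspace X. \<forall>u\<in>ball 0 (real k). \<forall>v\<in>ball 0 (real k). {u, v} \<in> E \<longrightarrow> c u \<noteq> c v}" for k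
  have topX: "topspace X = {c. \<forall>z. c z < n}" by (auto simp: X_def PiE_def)
  have "compact_space X" unfolding X_def by (simp add: compact_space_product_topology compact_space_discrete_topology)
  moreover have "closedin X (C k)" for k
  proof -
    have op: "openin X {c \<in> topspace X. c u = c v}" for u v
    proof -
      have 1: "openin X {c \<in> topspace X. c z \<in> {a}}" if "a < n" for z a
        by (rule openin_continuous_map_preimage[where Y = "discrete_topology {..<n}"])
           (use that continuous_map_product_projection[of z UNIV "\<lambda>_. discrete_topology {..<n}"]
             in \<open>simp_all add: X_def\<close>)
      have "c v < n" if "c \<in> topspace X" for c using that unfolding topX by blast
      then have "{c \<in> topspace X. c u = c v} =
          (\<Union>a<n. {c \<in> topspace X. c u \<in> {a}} \<inter> {c \<in> topspace X. c v \<in> {a}})"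
        by (intro set_eqI iffI) auto
      also have "openin X \<dots>" by (intro openin_Union) (blast intro: openin_Int 1)
      finally show ?thesis .
    qed
    have "topspace X - C k = (\<Union>(u, v)\<in>{(u, v). u \<in> ball 0 (real k) \<and> v \<in> ball 0 (real k) \<and> {u, v} \<in> E}.
        {c \<in> topspace X. c u = c v})"
      unfolding C_def by blast
    also have "openin X \<dots>" using op by (intro openin_Union) auto
    finally show ?thesis unfolding closedin_def by (auto simp: C_def)
  qed
  moreover have "C k \<noteq> {}" for k using assms[of "real k"] by (auto simp: C_def topX)
  moreover have "decseq C"
    unfolding decseq_def C_def by (intro allI impI Collect_mono) (auto dest: less_le_trans)
  ultimately have "(\<Inter>k. C k) \<noteq> {}" by (rule compact_space_imp_nest)
  then obtain c where c: "\<And>k. c \<in> C k" by blast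
  have "c u \<noteq> c v" if "{u, v} \<in> E" for u v
  proof -
    obtain k :: nat where "max (norm u) (norm v) < real k" using reals_Archimedean2 by blast
    then show ?thesis using c[of k] that by (auto simp: C_def)
  qed
  then show ?thesis using c[of 0] by (auto simp: C_def topX)
qed

text \<open>The triangle is child D of a tile \<open>t\<close> one level up. Its long-leg midpoint
  (1, 1) is inside \<open>t\<close> and is a corner of no tile, and its other two sides are never
  subdivided.\<close>

lemma pinwheel_triangle:
  assumes T: "rational_pinwheel_tiling T"
  obtains x y z where "x \<in> tiling_vertices T" "y \<in> tiling_vertices T" "z \<in> tiling_vertices T"
    "{x, y} \<in> tiling_edges T" "{y, z} \<in> tiling_edges T" "{x, z} \<in> tiling_edges T"
proof -
  obtain k g H where g: "isometry_plane g" "H = (\<lambda>z. g (sqrt 5 ^ Suc (Suc k) *\<^sub>R z))" and H: "affine_bij H"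
    and TQ: "\<And>s. s \<inter> ball 0 10 \<noteq> {} \<Longrightarrow> s \<in> T \<longleftrightarrow> s \<in> copy_level H (Suc (Suc k))"
    using pinwheel_tiling_agrees_with_level[OF T, of 10] by metis
  let ?Q = "copy_level H (Suc (Suc k))"
  obtain s where s: "s \<in> T" "0 \<in> s"
    using T unfolding rational_pinwheel_tiling_def tiling_by_def by (metis UNIV_I UnionE)
  moreover have "(0 :: plane) \<in> ball 0 10" by simp
  ultimately have "s \<inter> ball 0 10 \<noteq> {}" by blast
  then have "s \<in> ?Q" using TQ[of s] s(1) by blast
  then obtain d where "d \<in> refine (level (Suc k))" "s = H ` tile_of d" by (auto simp: copy_level_def)
  \<comment> \<open>The tile at the origin need not itself be of type D, so its parent is used; the
    parent lies within distance 6 of the origin, hence in the ball of radius 10.\<close>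
  then obtain t where t: "t \<in> level (Suc k)" "0 \<in> H ` tile_of t"
    using s(2) tile_of_child_subset unfolding refine_def by blast
  note nd = level_frames(1)[OF t(1)] and W = well_matched_level[of "Suc k"]
  have near: "H z \<in> ball 0 10" if "z \<in> tile_of t" for z
  proof -
    have "dist 0 (H z) \<le> 6"
      using dist_tile(1)[OF g(1) level_frames(1,3)[OF t(1)], of 0 "Suc (Suc k)" "H z"] t(2) that
      unfolding g(2) by blast
    then show ?thesis by simp
  qed
  have D: "chD t \<in> level (Suc (Suc k))" using t(1) by (auto simp: refine_def children_def)
  have DQ: "H ` tile_of (chD t) \<in> ?Q" using D by (auto simp: copy_level_def)
  have in_t: "x \<in> tile_of t" if "x \<in> tile_of (chD t)" for x
    using that tile_of_child_subset[of "chD t" t] by (auto simp: children_def)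
  have corner: "H x \<in> tiling_vertices ?Q" if "x \<in> corners (chD t)" for x
    unfolding copy_level_vertices[OF H] all_corners_def using D that by blast
  have edge: "{H x, H y} \<in> tiling_edges T"
    if xy: "x \<in> corners (chD t)" "y \<in> corners (chD t)" "x \<noteq> y"
      and side: "closed_segment x y \<subseteq> tile_of (chD t) - inner_tile (chD t)"
      and free: "\<And>z. z \<in> open_segment x y \<Longrightarrow> z \<notin> all_corners (level (Suc (Suc k)))" for x y
  proof -
    have "H x \<noteq> H y" using bij_is_inj[OF affine_bij_bij[OF H]] xy(3) by (simp add: inj_eq)
    moreover have "closed_segment (H x) (H y) \<subseteq> frontier (H ` tile_of (chD t))"
      unfolding affine_bij_segment(1)[OF H] frontier_tile[OF H level_frames(1)[OF D]] using side by blast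
    moreover have "open_segment (H x) (H y) \<inter> tiling_vertices ?Q = {}"
      unfolding affine_bij_segment(2)[OF H] copy_level_vertices[OF H]
        image_Int[OF bij_is_inj[OF affine_bij_bij[OF H]], symmetric] using free by blast
    ultimately have e: "{H x, H y} \<in> tiling_edges ?Q"
      using corner[OF xy(1)] corner[OF xy(2)] DQ unfolding tiling_edges_def by blast
    have "H x \<in> ball 0 10" "H y \<in> ball 0 10"
      using near in_t xy(1,2) corners_subset_marks marks_subset_tile by blast+
    then show ?thesis using edges_agree[of 10 ?Q T "H x" "H y"] TQ e by blast
  qed
  have side: "closed_segment a b \<subseteq> tile_of (chD t) - inner_tile (chD t)"
    and free: "\<And>z. z \<in> open_segment a b \<Longrightarrow> z \<notin> all_corners (level (Suc (Suc k)))"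
    if ab: "a = pt t x y" "b = pt t x' y'"
      and xy: "(x, y, x', y') \<in> {(1, 2, 2, 2), (2, 2, 1, 0), (1, 2, 1, 0)}" for a b x y x' y'
  proof -
    obtain p u v where puv: "t = (p, u, v)" by (cases t)
    have seg: "(1 - s) *\<^sub>R a + s *\<^sub>R b = pt t (x + s * (x' - x)) (y + s * (y' - y))" for s
      unfolding ab puv by (simp add: pt_def prod_eq_iff field_simps)
    show "closed_segment a b \<subseteq> tile_of (chD t) - inner_tile (chD t)"
    proof
      fix z assume "z \<in> closed_segment a b"
      then obtain s where s: "0 \<le> s" "s \<le> 1" "z = pt t (x + s * (x' - x)) (y + s * (y' - y))"
        by (auto simp: in_segment seg)
      then show "z \<in> tile_of (chD t) - inner_tile (chD t)"
        using xy by (auto simp: tile_of_child inner_tile_child pt_eq_iff[OF nd])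
    qed
    fix z assume "z \<in> open_segment a b"
    then obtain s where s: "0 < s" "s < 1" "z = pt t (x + s * (x' - x)) (y + s * (y' - y))"
      by (auto simp: in_segment seg)
    then have "z \<in> tile_of t" using xy by (auto intro!: pt_in_tile)
    then show "z \<notin> all_corners (level (Suc (Suc k)))"
      using refined_corner_cases[OF W t(1), of z] s xy
      by (auto simp: marks_pt_iff[OF nd] pt_eq_iff[OF nd])
  qed
  have c: "corners (chD t) = {pt t 1 2, pt t 2 2, pt t 1 0}" by (simp add: corners_def child_points)
  have "{H (pt t 1 2), H (pt t 2 2)} \<in> tiling_edges T" "{H (pt t 2 2), H (pt t 1 0)} \<in> tiling_edges T"
    "{H (pt t 1 2), H (pt t 1 0)} \<in> tiling_edges T"
    by (rule edge; (rule side[OF refl refl] free[OF refl refl])?; simp add: c pt_eq_iff[OF nd])+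
  moreover have "H x \<in> tiling_vertices T" if "x \<in> corners (chD t)" for x
    using vertices_agree[of 10 T ?Q, OF TQ] corner[OF that] near in_t that corners_subset_marks marks_subset_tile
    by blast
  ultimately show thesis using that c by blast
qed

theorem theorem5p2:
  fixes T :: "(real \<times> real) set set"
  assumes "rational_pinwheel_tiling T"
  shows "chromatic_number (tiling_vertices T) (tiling_edges T) = 3"
proof (rule antisym)
  have "\<exists>c. (\<forall>z. c z < 3) \<and> (\<forall>u v. {u, v} \<in> tiling_edges T \<longrightarrow> c u \<noteq> (c v :: nat))"
    by (rule colouring_by_compactness) (rule pinwheel_colouring_on_ball[OF assms])
  then obtain c where "\<forall>z. c z < 3" "\<forall>u v. {u, v} \<in> tiling_edges T \<longrightarrow> c u \<noteq> (c v :: nat)" by blast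
  then have "proper_colouring (tiling_vertices T) (tiling_edges T) 3 c"
    unfolding proper_colouring_def by blast
  then have "chromatic_number (tiling_vertices T) (tiling_edges T) \<le> enat 3"
    unfolding chromatic_number_def by (intro INF_lower) auto
  then show "chromatic_number (tiling_vertices T) (tiling_edges T) \<le> 3" by (simp add: numeral_eq_enat)
  obtain x y z where xyz: "x \<in> tiling_vertices T" "y \<in> tiling_vertices T" "z \<in> tiling_vertices T"
    "{x, y} \<in> tiling_edges T" "{y, z} \<in> tiling_edges T" "{x, z} \<in> tiling_edges T"
    using pinwheel_triangle[OF assms] .
  have "enat 3 \<le> enat k" if "proper_colouring (tiling_vertices T) (tiling_edges T) k c" for k c
  proof -
    have "c x \<noteq> c y" "c y \<noteq> c z" "c x \<noteq> c z" "c x < k" "c y < k" "c z < k"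
      using that xyz unfolding proper_colouring_def by blast+
    then show ?thesis by simp
  qed
  then have "enat 3 \<le> chromatic_number (tiling_vertices T) (tiling_edges T)"
    unfolding chromatic_number_def by (intro INF_greatest) auto
  then show "3 \<le> chromatic_number (tiling_vertices T) (tiling_edges T)" by (simp add: numeral_eq_enat)
qed

end
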